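(* Consider the $N$-agent system $dx_i=u_i\,dt+u_i\,dW_i$, $i=1,\dots,N$, with $\rho>0$. Assume A1) and $r>-\frac{1}{2(2+\rho)}$. Let $\hat x_i$ be the closed-loop states under the strategies $\hat u_i(t)=-\frac{p}{p+r}(x_i(t)-\bar x_0)$, $t\ge0$, $i=1,\dots,N$. Then there exist $c_1,c_2>0$ such that $$\mathbb{E}|\hat x_i(t)-\bar x_0|^2\le c_1e^{-c_2t},\quad t>0,\ 1\le i\le N,$$ which implies that all the agents achieve mean-square consensus.
   Context: Scalar model: $x_i,u_i\in\mathbb{R}$, $dx_i(t)=u_i(t)dt+u_i(t)dW_i(t)$, $i=1,\dots,N$, with $W_1,\dots,W_N$ mutually independent standard Brownian motions. The costs of the underlying game are $J_i(u_i,u_{-i})=\mathbb{E}\int_0^\infty e^{-\rho t}\{|x_i-x^{(N)}|^2+r|u_i|^2\}dt$, $x^{(N)}=\frac1N\sum_{j}x_j$, $\rho>0$, $r\in\mathbb{R}$ (possibly negative). A1) $x_i(0)$, $i=1,\dots,N$, are mutually independent with $\mathbb{E}x_i(0)\equiv\bar x_0$, $\max_{1\le i\le N}\mathbb{E}|x_i(0)|^2<c_0$ with $c_0$ independent of $N$; $\{x_i(0)\}$ and $\{W_i\}$ are independent. $p=\frac{1-\rho r+\sqrt\Delta}{2(\rho+1)}$ with $\Delta=(\rho r)^2+2\rho r+4r+1$; it is a solution of $\rho p=1-\frac{p^2}{r+p}$ with $p+r>0$. Mean-square consensus: there exists a random variable $x^*$ such that $\lim_{t\to\infty}\mathbb{E}|x_i(t)-x^*|^2=0$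 for all agents $i$. *)

theory Defs
  imports "HOL-Probability.Probability"
begin

text \<open>
  The libraries contain neither Brownian motion nor the Ito integral; both are set up here, for
  real-valued processes on the time set \<open>[0,\<infinity>)\<close>. A process is a function \<open>X :: real \<Rightarrow> 'a \<Rightarrow> real\<close>
  (time first), of which only the values at times \<open>t \<ge> 0\<close> matter.
\<close>

subsection \<open>Filtered probability spaces and processes\<close>

definition filtered_prob_space :: "'a measure \<Rightarrow> (real \<Rightarrow> 'a measure) \<Rightarrow> bool" where
  "filtered_prob_space M F \<longleftrightarrow>
     prob_space M \<and> filtration (space M) F \<and> (\<forall>t. subalgebra M (F t))"

definition adapted :: "(real \<Rightarrow> 'a measure) \<Rightarrow> (real \<Rightarrow> 'a \<Rightarrow> real) \<Rightarrow> bool" where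
  "adapted F X \<longleftrightarrow> (\<forall>t\<ge>0. X t \<in> borel_measurable (F t))"

definition progressive :: "(real \<Rightarrow> 'a measure) \<Rightarrow> (real \<Rightarrow> 'a \<Rightarrow> real) \<Rightarrow> bool" where
  "progressive F X \<longleftrightarrow>
     (\<forall>t\<ge>0. (\<lambda>(s, \<omega>). X s \<omega>) \<in> borel_measurable (restrict_space borel {0..t} \<Otimes>\<^sub>M F t))"

definition continuous_paths :: "'a measure \<Rightarrow> (real \<Rightarrow> 'a \<Rightarrow> real) \<Rightarrow> bool" where
  "continuous_paths M X \<longleftrightarrow> (AE \<omega> in M. continuous_on {0..} (\<lambda>t. X t \<omega>))"

definition brownian_motion ::
    "'a measure \<Rightarrow> (real \<Rightarrow> 'a measure) \<Rightarrow> (real \<Rightarrow> 'a \<Rightarrow> real) \<Rightarrow> bool" where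
  "brownian_motion M F W \<longleftrightarrow>
     adapted F W \<and> continuous_paths M W \<and> (AE \<omega> in M. W 0 \<omega> = 0) \<and>
     (\<forall>s t. 0 \<le> s \<and> s < t \<longrightarrow>
        distributed M lborel (\<lambda>\<omega>. W t \<omega> - W s \<omega>) (normal_density 0 (sqrt (t - s))) \<and>
        prob_space.indep_set M (sets (F s))
          (sets (vimage_algebra (space M) (\<lambda>\<omega>. W t \<omega> - W s \<omega>) borel)))"

subsection \<open>The stochastic integral\<close>

text \<open>
  A simple process is given by a number \<open>n\<close> of steps, a partition \<open>0 \<le> \<tau> 0 \<le> \<dots> \<le> \<tau> n\<close> and bounded
  \<open>F (\<tau> k)\<close>-measurable heights \<open>\<xi> k\<close>; its value is \<open>\<xi> k\<close> on \<open>(\<tau> k, \<tau> (k + 1)]\<close> and \<open>0\<close> elsewhere.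
\<close>

type_synonym 'a simple_data = "nat \<times> (nat \<Rightarrow> real) \<times> (nat \<Rightarrow> 'a \<Rightarrow> real)"

definition simple_data :: "'a measure \<Rightarrow> (real \<Rightarrow> 'a measure) \<Rightarrow> 'a simple_data \<Rightarrow> bool" where
  "simple_data M F = (\<lambda>(n, \<tau>, \<xi>).
     0 \<le> \<tau> 0 \<and> (\<forall>k<n. \<tau> k \<le> \<tau> (Suc k)) \<and>
     (\<forall>k<n. \<xi> k \<in> borel_measurable (F (\<tau> k)) \<and> (\<exists>B. \<forall>\<omega>\<in>space M. \<bar>\<xi> k \<omega>\<bar> \<le> B)))"

definition simple_process :: "'a simple_data \<Rightarrow> real \<Rightarrow> 'a \<Rightarrow> real" where
  "simple_process = (\<lambda>(n, \<tau>, \<xi>) s \<omega>. \<Sum>k<n. \<xi> k \<omega> * indicator {\<tau> k<..\<tau> (Suc k)} s)"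

definition simple_integral ::
    "(real \<Rightarrow> 'a \<Rightarrow> real) \<Rightarrow> 'a simple_data \<Rightarrow> real \<Rightarrow> 'a \<Rightarrow> real" where
  "simple_integral W = (\<lambda>(n, \<tau>, \<xi>) t \<omega>.
     \<Sum>k<n. \<xi> k \<omega> * (W (min (\<tau> (Suc k)) t) \<omega> - W (min (\<tau> k) t) \<omega>))"

definition vanishes_in_prob :: "'a measure \<Rightarrow> (nat \<Rightarrow> 'a \<Rightarrow> ennreal) \<Rightarrow> bool" where
  "vanishes_in_prob M Z \<longleftrightarrow>
     (\<forall>\<epsilon>>0. (\<lambda>n. measure M {\<omega> \<in> space M. Z n \<omega> > ennreal \<epsilon>}) \<longlonglongrightarrow> 0)"

text \<open>
  \<open>has_ito_integral M F W H t I\<close>: the random variable \<open>I\<close> is (a version of) the stochastic integral of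
  \<open>H\<close> against \<open>W\<close> over \<open>[0,t]\<close>. This is the usual definition for progressively measurable integrands
  whose square is almost surely integrable over \<open>[0,t]\<close>: \<open>I\<close> is the limit in probability of the
  integrals of simple processes approximating \<open>H\<close> in \<open>L\<^sup>2([0,t])\<close> in probability.
\<close>

definition has_ito_integral ::
    "'a measure \<Rightarrow> (real \<Rightarrow> 'a measure) \<Rightarrow> (real \<Rightarrow> 'a \<Rightarrow> real) \<Rightarrow> (real \<Rightarrow> 'a \<Rightarrow> real) \<Rightarrow>
     real \<Rightarrow> ('a \<Rightarrow> real) \<Rightarrow> bool" where
  "has_ito_integral M F W H t I \<longleftrightarrow>
     progressive F H \<and>
     (AE \<omega> in M. (\<integral>\<^sup>+s\<in>{0..t}. ennreal ((H s \<omega>)\<^sup>2) \<partial>lborel) < \<infinity>) \<and>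
     I \<in> borel_measurable M \<and>
     (\<exists>\<phi>. (\<forall>n. simple_data M F (\<phi> n)) \<and>
          vanishes_in_prob M
            (\<lambda>n \<omega>. \<integral>\<^sup>+s\<in>{0..t}. ennreal ((simple_process (\<phi> n) s \<omega> - H s \<omega>)\<^sup>2) \<partial>lborel) \<and>
          vanishes_in_prob M (\<lambda>n \<omega>. ennreal \<bar>simple_integral W (\<phi> n) t \<omega> - I \<omega>\<bar>))"

subsection \<open>The agents\<close>

text \<open>\<open>x\<close> solves \<open>dx = u dt + u dW\<close> for the control process \<open>u\<close>.\<close>

definition state_equation ::
    "'a measure \<Rightarrow> (real \<Rightarrow> 'a measure) \<Rightarrow> (real \<Rightarrow> 'a \<Rightarrow> real) \<Rightarrow> (real \<Rightarrow> 'a \<Rightarrow> real) \<Rightarrow>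
     (real \<Rightarrow> 'a \<Rightarrow> real) \<Rightarrow> bool" where
  "state_equation M F W u x \<longleftrightarrow>
     adapted F x \<and> continuous_paths M x \<and> progressive F u \<and>
     (\<forall>t\<ge>0. AE \<omega> in M. set_integrable lborel {0..t} (\<lambda>s. u s \<omega>)) \<and>
     (\<forall>t\<ge>0. \<exists>I. has_ito_integral M F W u t I \<and>
        (AE \<omega> in M. x t \<omega> = x 0 \<omega> + (LINT s:{0..t}|lborel. u s \<omega>) + I \<omega>))"

text \<open>
  The driving noises of \<open>N\<close> agents. Mutual independence is that of the whole processes, viewed as
  random elements of the product space \<open>\<real>\<^bsup>[0,\<infinity>)\<^esup>\<close>.
\<close>

definition independent_noises ::
    "'a measure \<Rightarrow> (real \<Rightarrow> 'a measure) \<Rightarrow> nat \<Rightarrow> (nat \<Rightarrow> real \<Rightarrow> 'a \<Rightarrow> real) \<Rightarrow> bool" where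
  "independent_noises M F N W \<longleftrightarrow>
     (\<forall>i\<in>{1..N}. brownian_motion M F (W i)) \<and>
     prob_space.indep_vars M (\<lambda>_. Pi\<^sub>M {0..} (\<lambda>_. borel)) (\<lambda>i \<omega>. \<lambda>t\<in>{0..}. W i t \<omega>) {1..N}"

text \<open>
  Assumption A1) for the initial states \<open>\<xi> 1, \<dots>, \<xi> N\<close>. Second moments are nonnegative integrals, so
  that the bound by \<open>c0\<close> includes their finiteness.
\<close>

definition assumption_A1 ::
    "'a measure \<Rightarrow> nat \<Rightarrow> (nat \<Rightarrow> real \<Rightarrow> 'a \<Rightarrow> real) \<Rightarrow> (nat \<Rightarrow> 'a \<Rightarrow> real) \<Rightarrow> real \<Rightarrow> real \<Rightarrow> bool" where
  "assumption_A1 M N W \<xi> xbar0 c0 \<longleftrightarrow>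
     prob_space.indep_vars M (\<lambda>_. borel) \<xi> {1..N} \<and>
     (\<forall>i\<in>{1..N}. integrable M (\<xi> i) \<and> prob_space.expectation M (\<xi> i) = xbar0) \<and>
     (\<forall>i\<in>{1..N}. (\<integral>\<^sup>+\<omega>. ennreal (\<bar>\<xi> i \<omega>\<bar>\<^sup>2) \<partial>M) < ennreal c0) \<and>
     prob_space.indep_set M
       (sets (vimage_algebra (space M) (\<lambda>\<omega>. \<lambda>i\<in>{1..N}. \<xi> i \<omega>) (Pi\<^sub>M {1..N} (\<lambda>_. borel))))
       (sets (vimage_algebra (space M) (\<lambda>\<omega>. \<lambda>(i, t)\<in>{1..N} \<times> {0..}. W i t \<omega>)
                (Pi\<^sub>M ({1..N} \<times> {0..}) (\<lambda>_. borel))))"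

definition discr :: "real \<Rightarrow> real \<Rightarrow> real" where
  "discr \<rho> r = (\<rho> * r)\<^sup>2 + 2 * \<rho> * r + 4 * r + 1"

definition p_coeff :: "real \<Rightarrow> real \<Rightarrow> real" where
  "p_coeff \<rho> r = (1 - \<rho> * r + sqrt (discr \<rho> r)) / (2 * (\<rho> + 1))"

definition strategy ::
    "real \<Rightarrow> real \<Rightarrow> real \<Rightarrow> (real \<Rightarrow> 'a \<Rightarrow> real) \<Rightarrow> real \<Rightarrow> 'a \<Rightarrow> real" where
  "strategy \<rho> r xbar0 x = (\<lambda>t \<omega>. - (p_coeff \<rho> r / (p_coeff \<rho> r + r)) * (x t \<omega> - xbar0))"

definition mean_square_consensus ::
    "'a measure \<Rightarrow> nat \<Rightarrow> (nat \<Rightarrow> real \<Rightarrow> 'a \<Rightarrow> real) \<Rightarrow> bool" where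
  "mean_square_consensus M N x \<longleftrightarrow>
     (\<exists>xs \<in> borel_measurable M. \<forall>i\<in>{1..N}.
        ((\<lambda>t. \<integral>\<^sup>+\<omega>. ennreal (\<bar>x i t \<omega> - xs \<omega>\<bar>\<^sup>2) \<partial>M) \<longlongrightarrow> 0) at_top)"

end

theory Submission
  imports Defs
begin

text \<open>
  Put \<open>a = p/(p+r)\<close>. Under the hypothesis on \<open>r\<close> one has \<open>0 < a < 2\<close>, and \<open>Y = x - xbar0\<close> solves
  \<open>dY = -a Y dt - a Y dW\<close>, whose second moment should decay at rate \<open>c = 2a - a\<^sup>2 > 0\<close>. Instead of Ito's
  formula we use the Euler scheme \<open>E(k+1) = E(k) (1 - a h - a \<Delta>W)\<close> with \<open>h = T/n\<close>: its second moment
  is exactly \<open>((1 - a h)\<^sup>2 + a\<^sup>2 h)\<^sup>k E|Y(0)|\<^sup>2\<close>, which at time \<open>T\<close> tends to \<open>e\<^bsup>-cT\<^esup> E|Y(0)|\<^sup>2\<close>.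
  So it suffices that the scheme converges to \<open>Y(T)\<close> in probability, since second moments are lower
  semicontinuous under that convergence.

  For the convergence, \<open>Y\<close> on the grid satisfies the Euler recursion up to a residual. A Lenglart-type
  maximal inequality for stochastic integrals shows that this residual is uniformly small over the
  grid with high probability. After truncating it at level \<open>\<epsilon>\<close>, a discrete Gronwall argument bounds
  the second moment of its effect on the scheme by a constant times \<open>\<epsilon>\<^sup>2\<close>.
\<close>

subsection \<open>The feedback gain\<close>

text \<open>The state equation supplies the stochastic integral only as a limit in probability, one
  time at a time, and no second moment of \<open>Y T\<close> is known beforehand. So all moments are
  taken of discrete quantities, and \<open>Y\<close> at positive times enters through probabilities.
  Two obstacles follow. The approximating sequences attached to different times are unrelated, so
  the integral must first be shown not to depend on them; and the maximal inequality needs a bound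
  free of the number of times, because the grids grow with \<open>n\<close>. Moreover the residual
  may fail to be square-integrable; truncated it is bounded and adapted, and off an event of
  vanishing probability the truncation changes nothing. The rate comes from
  \<open>(1 - a h)^2 + a^2 h = 1 - (2 a - a^2) h + a^2 h^2\<close>: noise proportional to the state
  takes \<open>a^2\<close> from the damping \<open>2 a\<close>, and for positive \<open>a\<close>
  what remains is positive exactly when \<open>a < 2\<close>.\<close>

lemma feedback_gain_bounds:
  fixes \<rho> r :: real
  assumes "\<rho> > 0" and r: "r > - 1 / (2 * (2 + \<rho>))"
  defines "a \<equiv> p_coeff \<rho> r / (p_coeff \<rho> r + r)"
  shows "0 < a" and "a < 2"
proof -
  define S where "S = sqrt (discr \<rho> r)"
  define p where "p = p_coeff \<rho> r"
  have p: "p = (1 - \<rho> * r + S) / (2 * (\<rho> + 1))"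
    by (simp add: p_def p_coeff_def S_def)
  have r': "1 + 2 * r * (\<rho> + 2) > 0"
    using r assms(1) by (simp add: field_simps)
  \<comment> \<open>Once \<open>p + r > 0\<close>, the bound \<open>p / (p + r) < 2\<close> amounts
    to \<open>p + 2 * r > 0\<close>.\<close>
  have "discr \<rho> r > 0 \<and> p > 0 \<and> p + 2 * r > 0"
  proof (cases "r < 0")
    case True
    \<comment> \<open>Since \<open>2 * (\<rho> + 1) * (p + 2 * r) = 1 + (3 * \<rho> + 4) * r +
      S\<close>, it suffices that \<open>S\<close> exceeds the absolute value of
      \<open>1 + (3 * \<rho> + 4) * r\<close>. The last factor on the right is positive exactly
      under the hypothesis on \<open>r\<close>: this is where the threshold comes from.\<close>
    have "discr \<rho> r - (1 + (3 * \<rho> + 4) * r)\<^sup>2 = 4 * (\<rho> + 1) * (- r) * (1 + 2 * r * (\<rho> + 2))"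
      by (simp add: discr_def power2_eq_square algebra_simps)
    moreover have "\<dots> > 0"
      using True assms(1) r' by (intro mult_pos_pos) auto
    ultimately have *: "discr \<rho> r > (1 + (3 * \<rho> + 4) * r)\<^sup>2" by simp
    hence d: "discr \<rho> r > 0"
      by (smt (verit) zero_le_power2)
    have "S > \<bar>1 + (3 * \<rho> + 4) * r\<bar>"
      unfolding S_def using * by (simp add: real_less_rsqrt)
    hence "1 + (3 * \<rho> + 4) * r + S > 0" by linarith
    moreover have "p + 2 * r = (1 + (3 * \<rho> + 4) * r + S) / (2 * (\<rho> + 1))"
      unfolding p using assms(1) by (simp add: field_simps)
    ultimately have "p + 2 * r > 0" using assms(1) by simp
    with d True show ?thesis by auto
  next
    case False
    show ?thesis
    proof (cases "r = 0")
      case True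
      thus ?thesis using assms(1) by (simp add: p S_def discr_def)
    next
      case nz: False
      have "discr \<rho> r - (1 - \<rho> * r)\<^sup>2 = 4 * (\<rho> + 1) * r"
        by (simp add: discr_def power2_eq_square algebra_simps)
      hence *: "discr \<rho> r > (1 - \<rho> * r)\<^sup>2"
        using False nz assms(1) by (smt (verit) mult_pos_pos)
      hence d: "discr \<rho> r > 0"
        by (smt (verit) zero_le_power2)
      have "S > \<bar>1 - \<rho> * r\<bar>"
        unfolding S_def using * by (simp add: real_less_rsqrt)
      hence "p > 0" unfolding p using assms(1) by (simp add: field_simps)
      with d False show ?thesis by auto
    qed
  qed
  hence *: "p > 0" "p + r > 0" "p + 2 * r > 0" by auto
  show "0 < a"
    unfolding a_def p_def[symmetric] using * by simp
  show "a < 2"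
    unfolding a_def p_def[symmetric] using * by (simp add: pos_divide_less_eq)
qed

subsection \<open>Square-integrable random variables and Brownian increments\<close>

locale brownian_filtration = prob_space M
  for M :: "'a measure" +
  fixes F :: "real \<Rightarrow> 'a measure" and W :: "real \<Rightarrow> 'a \<Rightarrow> real"
  assumes filtered: "filtered_prob_space M F"
    and brownian: "brownian_motion M F W"
begin

text \<open>Measurability at time \<open>t\<close>, not merely in \<open>M\<close>, is what makes
  such a variable independent of all increments of \<open>W\<close> after \<open>t\<close>.\<close>

definition sq_int :: "real \<Rightarrow> ('a \<Rightarrow> real) \<Rightarrow> bool" where
  "sq_int t X \<longleftrightarrow> X \<in> borel_measurable (F t) \<and> integrable M (\<lambda>\<omega>. (X \<omega>)\<^sup>2)"

lemma space_F [simp]: "space (F t) = space M"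
  using filtered by (simp add: filtered_prob_space_def filtration_def)

lemma sets_F_mono: "s \<le> t \<Longrightarrow> sets (F s) \<subseteq> sets (F t)"
  using filtered by (simp add: filtered_prob_space_def filtration_def)

lemma sets_F: "sets (F t) \<subseteq> sets M"
  using filtered by (simp add: filtered_prob_space_def subalgebra_def)

lemma measurable_F_mono: "X \<in> measurable (F s) N \<Longrightarrow> s \<le> t \<Longrightarrow> X \<in> measurable (F t) N"
  using sets_F_mono[of s t] by (auto simp: measurable_def)

lemma measurable_F: "X \<in> measurable (F t) N \<Longrightarrow> X \<in> measurable M N"
  using sets_F[of t] by (auto simp: measurable_def)

lemma measurable_W_F: "0 \<le> t \<Longrightarrow> W t \<in> borel_measurable (F t)"
  using brownian by (simp add: brownian_motion_def adapted_def)

lemma measurable_W: "0 \<le> t \<Longrightarrow> W t \<in> borel_measurable M"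
  using measurable_F measurable_W_F by blast

lemma integrable_mult_sq:
  assumes "X \<in> borel_measurable M" "Y \<in> borel_measurable M"
    and "integrable M (\<lambda>\<omega>. (X \<omega>)\<^sup>2)" "integrable M (\<lambda>\<omega>. (Y \<omega>)\<^sup>2 :: real)"
  shows "integrable M (\<lambda>\<omega>. X \<omega> * Y \<omega> :: real)"
proof (rule Bochner_Integration.integrable_bound)
  show "integrable M (\<lambda>\<omega>. (X \<omega>)\<^sup>2 + (Y \<omega>)\<^sup>2)" using assms by simp
  have "\<bar>x * y\<bar> \<le> x\<^sup>2 + y\<^sup>2" for x y :: real
  proof -
    have "0 \<le> \<bar>x\<bar> * \<bar>y\<bar>" by simp
    with sum_squares_bound[of "\<bar>x\<bar>" "\<bar>y\<bar>"] show ?thesis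
      unfolding abs_mult power2_abs by linarith
  qed
  thus "AE \<omega> in M. norm (X \<omega> * Y \<omega>) \<le> norm ((X \<omega>)\<^sup>2 + (Y \<omega>)\<^sup>2)" by simp
qed (use assms in measurable)

lemma sq_int_bounded:
  assumes X: "X \<in> borel_measurable (F t)" and B: "\<And>\<omega>. \<omega> \<in> space M \<Longrightarrow> \<bar>X \<omega>\<bar> \<le> B"
  shows "sq_int t X"
  unfolding sq_int_def
proof
  show "integrable M (\<lambda>\<omega>. (X \<omega>)\<^sup>2)"
  proof (rule integrable_const_bound[where B="B\<^sup>2"])
    have "(X \<omega>)\<^sup>2 \<le> B\<^sup>2" if "\<omega> \<in> space M" for \<omega>
      using power_mono[OF B[OF that], of 2] by simp
    thus "AE \<omega> in M. norm ((X \<omega>)\<^sup>2) \<le> B\<^sup>2" by (intro AE_I2) simp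
    show "(\<lambda>\<omega>. (X \<omega>)\<^sup>2) \<in> borel_measurable M"
      using measurable_F[OF X] by (rule borel_measurable_power)
  qed
qed (rule X)

lemma sq_int_lin:
  assumes "sq_int t X" "sq_int t Y"
  shows "sq_int t (\<lambda>\<omega>. b * X \<omega> + c * Y \<omega>)"
proof -
  have [measurable]: "X \<in> borel_measurable (F t)" "Y \<in> borel_measurable (F t)"
    using assms by (auto simp: sq_int_def)
  have "integrable M (\<lambda>\<omega>. X \<omega> * Y \<omega>)"
    using assms by (intro integrable_mult_sq) (auto simp: sq_int_def intro: measurable_F[of _ t])
  hence "integrable M (\<lambda>\<omega>. b\<^sup>2 * (X \<omega>)\<^sup>2 + 2 * b * c * (X \<omega> * Y \<omega>) + c\<^sup>2 * (Y \<omega>)\<^sup>2)"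
    using assms by (auto simp: sq_int_def)
  thus ?thesis
    by (simp add: sq_int_def power2_sum power_mult_distrib algebra_simps)
qed

lemma indep_increment:
  assumes "0 \<le> s" "s < t" and [measurable]: "V \<in> borel_measurable (F s)"
  shows "indep_var borel V borel (\<lambda>\<omega>. W t \<omega> - W s \<omega>)"
proof -
  have ind: "indep_set (sets (F s)) (sets (vimage_algebra (space M) (\<lambda>\<omega>. W t \<omega> - W s \<omega>) borel))"
    using brownian assms by (simp add: brownian_motion_def)
  have V: "V \<in> borel_measurable M" using assms(3) by (rule measurable_F)
  have "(\<lambda>\<omega>. W t \<omega> - W s \<omega>) \<in> borel_measurable M"
    using assms by (intro borel_measurable_diff measurable_W) auto
  moreover have "sigma_sets (space M) {V -` A \<inter> space M |A. A \<in> sets borel} \<subseteq> sets (F s)"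
    using measurable_sets[OF assms(3)] sets.sigma_sets_subset[of _ "F s"]
    by (intro sets.sigma_sets_subset[of _ "F s", simplified]) auto
  moreover have "sigma_sets (space M) {(\<lambda>\<omega>. W t \<omega> - W s \<omega>) -` A \<inter> space M |A. A \<in> sets borel}
      \<subseteq> sets (vimage_algebra (space M) (\<lambda>\<omega>. W t \<omega> - W s \<omega>) borel)"
    by (simp add: sets_vimage_algebra)
  ultimately show ?thesis
    using ind V unfolding indep_var_eq indep_set_def
    by (auto elim!: indep_sets_mono_sets simp del: sets_vimage_algebra split: bool.splits)
qed

lemma increment_moments:
  assumes "0 \<le> s" "s < t"
  shows "integrable M (\<lambda>\<omega>. W t \<omega> - W s \<omega>)" "expectation (\<lambda>\<omega>. W t \<omega> - W s \<omega>) = 0"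
    and "integrable M (\<lambda>\<omega>. (W t \<omega> - W s \<omega>)\<^sup>2)" "expectation (\<lambda>\<omega>. (W t \<omega> - W s \<omega>)\<^sup>2) = t - s"
proof -
  let ?D = "\<lambda>\<omega>. W t \<omega> - W s \<omega>"
  have D: "distributed M lborel ?D (normal_density 0 (sqrt (t - s)))"
    using brownian assms by (simp add: brownian_motion_def)
  have pos: "0 < sqrt (t - s)" using assms by simp
  show "integrable M ?D"
    using distributed_integrable[OF D, of "\<lambda>x. x"] integrable_normal_moment_nz_1[OF pos, of 0]
    by simp
  show "expectation ?D = 0"
    using normal_distributed_expectation[OF pos D] .
  show "integrable M (\<lambda>\<omega>. (?D \<omega>)\<^sup>2)"
    using distributed_integrable[OF D, of "\<lambda>x. x\<^sup>2"] integrable_normal_moment[OF pos, of 0 2]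
    by simp
  show "expectation (\<lambda>\<omega>. (?D \<omega>)\<^sup>2) = t - s"
    using normal_distributed_variance[OF pos D] \<open>expectation ?D = 0\<close> assms by simp
qed

text \<open>One step of the Ito isometry. The cross term \<open>2 * U * V * (W t - W s)\<close> has
  mean zero because \<open>U * V\<close> is independent of a centred increment; independence also
  makes \<open>V^2 * (W t - W s)^2\<close> integrable, with no bound on \<open>V\<close>.\<close>

lemma increment_sq:
  assumes st: "0 \<le> s" "s \<le> t" and U: "sq_int s U" and V: "sq_int s V"
  shows "sq_int t (\<lambda>\<omega>. U \<omega> + V \<omega> * (W t \<omega> - W s \<omega>))"
    and "expectation (\<lambda>\<omega>. (U \<omega> + V \<omega> * (W t \<omega> - W s \<omega>))\<^sup>2)
      = expectation (\<lambda>\<omega>. (U \<omega>)\<^sup>2) + (t - s) * expectation (\<lambda>\<omega>. (V \<omega>)\<^sup>2)"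
proof -
  let ?D = "\<lambda>\<omega>. W t \<omega> - W s \<omega>"
  let ?S = "\<lambda>\<omega>. U \<omega> + V \<omega> * ?D \<omega>"
  have UF[measurable]: "U \<in> borel_measurable (F s)" "V \<in> borel_measurable (F s)"
    using U V by (auto simp: sq_int_def)
  have [measurable]: "U \<in> borel_measurable (F t)" "V \<in> borel_measurable (F t)"
    "W s \<in> borel_measurable (F t)" "W t \<in> borel_measurable (F t)"
    using UF st measurable_W_F measurable_W_F[of s] by (auto intro: measurable_F_mono[OF _ st(2)])
  have m: "?S \<in> borel_measurable (F t)" by measurable
  have "integrable M (\<lambda>\<omega>. (?S \<omega>)\<^sup>2) \<and> expectation (\<lambda>\<omega>. (?S \<omega>)\<^sup>2)
      = expectation (\<lambda>\<omega>. (U \<omega>)\<^sup>2) + (t - s) * expectation (\<lambda>\<omega>. (V \<omega>)\<^sup>2)"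
  \<comment> \<open>The law of an increment is prescribed only for \<open>s < t\<close>; partitions
    of simple data may have repeated points.\<close>
  proof (cases "s = t")
    case True
    thus ?thesis using U by (simp add: sq_int_def)
  next
    case False
    hence lt: "s < t" using st by simp
    note mom = increment_moments[OF st(1) lt]
    have UV: "integrable M (\<lambda>\<omega>. 2 * (U \<omega> * V \<omega>))"
      using integrable_mult_sq[OF measurable_F[OF UF(1)] measurable_F[OF UF(2)]] U V
      by (simp add: sq_int_def)
    have i1: "indep_var borel (\<lambda>\<omega>. 2 * (U \<omega> * V \<omega>)) borel ?D"
      by (rule indep_increment[OF st(1) lt]) measurable
    have "indep_var borel ((\<lambda>x. x\<^sup>2) \<circ> V) borel ((\<lambda>x. x\<^sup>2) \<circ> ?D)"
      by (rule indep_var_compose[OF indep_increment[OF st(1) lt]]) auto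
    hence i2: "indep_var borel (\<lambda>\<omega>. (V \<omega>)\<^sup>2) borel (\<lambda>\<omega>. (?D \<omega>)\<^sup>2)"
      by (simp add: o_def)
    have V2: "integrable M (\<lambda>\<omega>. (V \<omega>)\<^sup>2)" and U2: "integrable M (\<lambda>\<omega>. (U \<omega>)\<^sup>2)"
      using U V by (auto simp: sq_int_def)
    have eq: "(\<lambda>\<omega>. (?S \<omega>)\<^sup>2) = (\<lambda>\<omega>. (U \<omega>)\<^sup>2 + (2 * (U \<omega> * V \<omega>)) * ?D \<omega> + (V \<omega>)\<^sup>2 * (?D \<omega>)\<^sup>2)"
      by (auto simp: fun_eq_iff power2_eq_square algebra_simps)
    show ?thesis
      unfolding eq
      using indep_var_integrable[OF i1 UV mom(1)] indep_var_lebesgue_integral[OF i1 UV mom(1)]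
        indep_var_integrable[OF i2 V2 mom(3)] indep_var_lebesgue_integral[OF i2 V2 mom(3)] U2 mom
      by simp
  qed
  with m show "sq_int t ?S" "expectation (\<lambda>\<omega>. (?S \<omega>)\<^sup>2)
      = expectation (\<lambda>\<omega>. (U \<omega>)\<^sup>2) + (t - s) * expectation (\<lambda>\<omega>. (V \<omega>)\<^sup>2)"
    by (auto simp: sq_int_def)
qed

subsection \<open>Simple integrals: maximal inequality\<close>

lemma simple_dataD:
  assumes "simple_data M F (n, \<tau>, \<xi>)"
  shows "0 \<le> \<tau> 0" "k < n \<Longrightarrow> \<tau> k \<le> \<tau> (Suc k)" "k < n \<Longrightarrow> \<xi> k \<in> borel_measurable (F (\<tau> k))"
    "k < n \<Longrightarrow> \<exists>B. \<forall>\<omega>\<in>space M. \<bar>\<xi> k \<omega>\<bar> \<le> B"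
  using assms by (auto simp: simple_data_def)

lemma simple_data_mono:
  assumes "simple_data M F (n, \<tau>, \<xi>)" "i \<le> j" "j \<le> n"
  shows "\<tau> i \<le> \<tau> j"
  using assms(2,3)
proof (induction j)
  case (Suc j)
  show ?case
  proof (cases "i = Suc j")
    case False
    with Suc have "\<tau> i \<le> \<tau> j" by simp
    also have "\<dots> \<le> \<tau> (Suc j)" using simple_dataD(2)[OF assms(1)] Suc.prems by simp
    finally show ?thesis .
  qed simp
qed simp

lemma simple_data_nonneg:
  assumes "simple_data M F (n, \<tau>, \<xi>)" "j \<le> n"
  shows "0 \<le> \<tau> j"
  using simple_dataD(1)[OF assms(1)] simple_data_mono[OF assms(1), of 0 j] assms(2) by simp

lemma prob_abs_gt_le:
  assumes "X \<in> borel_measurable M" "integrable M (\<lambda>\<omega>. (X \<omega>)\<^sup>2)" "0 < (\<epsilon>::real)"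
  shows "prob {\<omega>\<in>space M. \<epsilon> < \<bar>X \<omega>\<bar>} \<le> expectation (\<lambda>\<omega>. (X \<omega>)\<^sup>2) / \<epsilon>\<^sup>2"
proof -
  have [measurable]: "X \<in> borel_measurable M" by fact
  have "prob {\<omega>\<in>space M. \<epsilon> < \<bar>X \<omega>\<bar>} \<le> prob {\<omega>\<in>space M. \<epsilon>\<^sup>2 \<le> (X \<omega>)\<^sup>2}"
  proof (rule finite_measure_mono)
    show "{\<omega>\<in>space M. \<epsilon> < \<bar>X \<omega>\<bar>} \<subseteq> {\<omega>\<in>space M. \<epsilon>\<^sup>2 \<le> (X \<omega>)\<^sup>2}"
      using \<open>0 < \<epsilon>\<close> by (auto simp flip: abs_le_square_iff)
  qed measurable
  also have "\<dots> \<le> expectation (\<lambda>\<omega>. (X \<omega>)\<^sup>2) / \<epsilon>\<^sup>2"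
    using assms by (intro integral_Markov_inequality_measure[where A="{}"]) auto
  finally show ?thesis .
qed

text \<open>
  Stopping the integrand once its square integral exceeds \<open>\<delta>\<close> or the integral itself exceeds \<open>\<epsilon>\<close>
  yields an integral with second moment at most \<open>\<delta>\<close> which stays frozen above \<open>\<epsilon>\<close>.
\<close>

lemma simple_maximal_inequality:
  assumes sd: "simple_data M F (m, \<sigma>, \<zeta>)" and "0 < \<epsilon>" and "0 \<le> \<delta>"
  shows "prob {\<omega>\<in>space M. \<exists>j\<le>m. \<epsilon> < \<bar>\<Sum>k<j. \<zeta> k \<omega> * (W (\<sigma> (Suc k)) \<omega> - W (\<sigma> k) \<omega>)\<bar>}
    \<le> prob {\<omega>\<in>space M. \<delta> < (\<Sum>k<m. (\<zeta> k \<omega>)\<^sup>2 * (\<sigma> (Suc k) - \<sigma> k))} + \<delta> / \<epsilon>\<^sup>2"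
proof -
  define S where "S j \<omega> = (\<Sum>k<j. \<zeta> k \<omega> * (W (\<sigma> (Suc k)) \<omega> - W (\<sigma> k) \<omega>))" for j \<omega>
  define Q where "Q j \<omega> = (\<Sum>k<j. (\<zeta> k \<omega>)\<^sup>2 * (\<sigma> (Suc k) - \<sigma> k))" for j \<omega>
  \<comment> \<open>The test looks at \<open>Q (Suc k)\<close>, which already includes the coming
    step. This is allowed because \<open>\<zeta> k\<close> and the step length are known at time
    \<open>\<sigma> k\<close>, and it prevents the square integral from overshooting
    \<delta>.\<close>
  define N where "N = rec_nat (\<lambda>\<omega>. 0) (\<lambda>k Nk \<omega>. Nk \<omega> +
    (if \<bar>Nk \<omega>\<bar> \<le> \<epsilon> \<and> Q (Suc k) \<omega> \<le> \<delta> then \<zeta> k \<omega> else 0) * (W (\<sigma> (Suc k)) \<omega> - W (\<sigma> k) \<omega>))"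
  define Z where "Z k \<omega> = (if \<bar>N k \<omega>\<bar> \<le> \<epsilon> \<and> Q (Suc k) \<omega> \<le> \<delta> then \<zeta> k \<omega> else 0)" for k \<omega>
  have N0: "N 0 = (\<lambda>\<omega>. 0)" by (simp add: N_def)
  have NS: "N (Suc k) = (\<lambda>\<omega>. N k \<omega> + Z k \<omega> * (W (\<sigma> (Suc k)) \<omega> - W (\<sigma> k) \<omega>))" for k
    by (simp add: N_def Z_def)
  note sdD = simple_dataD[OF sd]
  note sd_mono = simple_data_mono[OF sd]
  note sd_nonneg = simple_data_nonneg[OF sd]
  have Q_meas: "Q j \<in> borel_measurable (F (\<sigma> k))" if "j \<le> Suc k" "k < m" for j k
    unfolding Q_def
  proof (intro borel_measurable_sum borel_measurable_times borel_measurable_power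
      borel_measurable_const)
    fix i assume "i \<in> {..<j}"
    with that have "\<sigma> i \<le> \<sigma> k" "i < m" using sd_mono[of i k] by auto
    thus "\<zeta> i \<in> borel_measurable (F (\<sigma> k))" using sdD(3)[of i] by (blast intro: measurable_F_mono)
  qed
  have Z_sq: "sq_int (\<sigma> k) (Z k)" if k: "k < m" and Nk: "sq_int (\<sigma> k) (N k)" for k
  proof -
    have [measurable]: "N k \<in> borel_measurable (F (\<sigma> k))" "\<zeta> k \<in> borel_measurable (F (\<sigma> k))"
      "Q (Suc k) \<in> borel_measurable (F (\<sigma> k))"
      using Nk sdD(3)[OF k] Q_meas[OF order.refl k] by (auto simp: sq_int_def)
    have Zm: "Z k \<in> borel_measurable (F (\<sigma> k))" unfolding Z_def by measurable
    from sdD(4)[OF k] obtain B where B: "\<And>\<omega>. \<omega> \<in> space M \<Longrightarrow> \<bar>\<zeta> k \<omega>\<bar> \<le> B" by blast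
    have "\<bar>Z k \<omega>\<bar> \<le> B" if "\<omega> \<in> space M" for \<omega>
      using B[OF that] by (auto simp: Z_def)
    with Zm show ?thesis by (rule sq_int_bounded)
  qed
  \<comment> \<open>Square-integrability of \<open>N j\<close> has to be part of the induction,
    since the height \<open>Z j\<close> depends on \<open>N j\<close>.\<close>
  have main: "sq_int (\<sigma> j) (N j) \<and> (\<forall>k<j. integrable M (\<lambda>\<omega>. (Z k \<omega>)\<^sup>2)) \<and> expectation (\<lambda>\<omega>. (N j \<omega>)\<^sup>2)
      = (\<Sum>k<j. (\<sigma> (Suc k) - \<sigma> k) * expectation (\<lambda>\<omega>. (Z k \<omega>)\<^sup>2))" if "j \<le> m" for j
    using that
  proof (induction j)
    case 0
    show ?case by (simp add: N0 sq_int_def)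
  next
    case (Suc j)
    hence IH: "sq_int (\<sigma> j) (N j)" "\<forall>k<j. integrable M (\<lambda>\<omega>. (Z k \<omega>)\<^sup>2)"
      "expectation (\<lambda>\<omega>. (N j \<omega>)\<^sup>2) = (\<Sum>k<j. (\<sigma> (Suc k) - \<sigma> k) * expectation (\<lambda>\<omega>. (Z k \<omega>)\<^sup>2))"
      and j: "j < m" by auto
    note Zj = Z_sq[OF j IH(1)]
    note inc = increment_sq[OF sd_nonneg[of j] sdD(2)[OF j] IH(1) Zj]
    show ?case
      using inc IH Zj j by (auto simp: NS less_Suc_eq sq_int_def)
  qed
  \<comment> \<open>The bound by \<delta> alone would not survive the induction: when a step is
    taken, one needs that the sum so far is at most \<open>Q j\<close>, so that the new sum is at
    most \<open>Q (Suc j)\<close>, which the test keeps below \<delta>.\<close>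
  have Z_sum: "(\<Sum>k<j. (Z k \<omega>)\<^sup>2 * (\<sigma> (Suc k) - \<sigma> k)) \<le> min \<delta> (Q j \<omega>)" if "j \<le> m" for j \<omega>
    using that
  proof (induction j)
    case 0
    show ?case using \<open>0 \<le> \<delta>\<close> by (simp add: Q_def)
  next
    case (Suc j)
    hence IH: "(\<Sum>k<j. (Z k \<omega>)\<^sup>2 * (\<sigma> (Suc k) - \<sigma> k)) \<le> min \<delta> (Q j \<omega>)" and j: "j < m" by auto
    have "(\<zeta> j \<omega>)\<^sup>2 * (\<sigma> (Suc j) - \<sigma> j) \<ge> 0" using sdD(2)[OF j] by simp
    moreover have "Q (Suc j) \<omega> = Q j \<omega> + (\<zeta> j \<omega>)\<^sup>2 * (\<sigma> (Suc j) - \<sigma> j)" by (simp add: Q_def)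
    ultimately show ?case using IH by (auto simp: Z_def)
  qed
  have N_m: "sq_int (\<sigma> m) (N m)" and Z_int: "\<And>k. k < m \<Longrightarrow> integrable M (\<lambda>\<omega>. (Z k \<omega>)\<^sup>2)"
    using main[of m] by auto
  have "expectation (\<lambda>\<omega>. (N m \<omega>)\<^sup>2) = expectation (\<lambda>\<omega>. \<Sum>k<m. (Z k \<omega>)\<^sup>2 * (\<sigma> (Suc k) - \<sigma> k))"
    using main[of m] by (simp add: Bochner_Integration.integral_sum mult.commute)
  also have "\<dots> \<le> expectation (\<lambda>\<omega>. \<delta>)"
    using Z_sum[of m] Z_int by (intro integral_mono Bochner_Integration.integrable_sum) auto
  finally have N_le: "expectation (\<lambda>\<omega>. (N m \<omega>)\<^sup>2) \<le> \<delta>" by (simp add: prob_space)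
  have N_meas: "N m \<in> borel_measurable M"
    using N_m by (auto simp: sq_int_def intro: measurable_F)
  \<comment> \<open>If \<open>Q m\<close> stays below \<delta>, only the test on \<open>N\<close>
    can stop the integral. Then \<open>N\<close> follows \<open>S\<close> up to the first passage
    above \<epsilon> and stays there, even if \<open>S\<close> returns. Hence a passage at any time
    is visible at the last index \<open>m\<close>, where Chebyshev applies.\<close>
  have frozen: "((\<forall>i\<le>j. \<bar>S i \<omega>\<bar> \<le> \<epsilon>) \<longrightarrow> N j \<omega> = S j \<omega>) \<and>
      ((\<exists>i\<le>j. \<epsilon> < \<bar>S i \<omega>\<bar>) \<longrightarrow> \<epsilon> < \<bar>N j \<omega>\<bar>)" if Qm: "Q m \<omega> \<le> \<delta>" and "j \<le> m" for j \<omega>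
    using that(2)
  proof (induction j)
    case 0
    show ?case using \<open>0 < \<epsilon>\<close> by (simp add: N0 S_def)
  next
    case (Suc j)
    have "Q (Suc j) \<omega> \<le> Q m \<omega>"
      unfolding Q_def using Suc.prems sdD(2) by (intro sum_mono2) auto
    with Qm have Q: "Q (Suc j) \<omega> \<le> \<delta>" by simp
    have SS: "S (Suc j) \<omega> = S j \<omega> + \<zeta> j \<omega> * (W (\<sigma> (Suc j)) \<omega> - W (\<sigma> j) \<omega>)" by (simp add: S_def)
    show ?case
    proof (cases "\<forall>i\<le>j. \<bar>S i \<omega>\<bar> \<le> \<epsilon>")
      case True
      with Suc have "N j \<omega> = S j \<omega>" by auto
      with True Q have "N (Suc j) \<omega> = S (Suc j) \<omega>" by (auto simp: NS SS Z_def)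
      with True show ?thesis by (auto simp: le_Suc_eq not_less)
    next
      case False
      with Suc have "\<epsilon> < \<bar>N j \<omega>\<bar>" by (auto simp: not_le)
      hence "N (Suc j) \<omega> = N j \<omega>" by (simp add: NS Z_def)
      with False \<open>\<epsilon> < \<bar>N j \<omega>\<bar>\<close> show ?thesis by (auto intro: le_SucI)
    qed
  qed
  have Qm_meas: "Q m \<in> borel_measurable M"
    unfolding Q_def using measurable_F[OF sdD(3)]
    by (intro borel_measurable_sum borel_measurable_times borel_measurable_power) auto
  have "prob {\<omega>\<in>space M. \<exists>j\<le>m. \<epsilon> < \<bar>S j \<omega>\<bar>}
      \<le> prob ({\<omega>\<in>space M. \<delta> < Q m \<omega>} \<union> {\<omega>\<in>space M. \<epsilon> < \<bar>N m \<omega>\<bar>})"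
  proof (rule finite_measure_mono)
    show "{\<omega>\<in>space M. \<exists>j\<le>m. \<epsilon> < \<bar>S j \<omega>\<bar>}
        \<subseteq> {\<omega>\<in>space M. \<delta> < Q m \<omega>} \<union> {\<omega>\<in>space M. \<epsilon> < \<bar>N m \<omega>\<bar>}"
      using frozen[OF _ order.refl] not_less by blast
  qed (use Qm_meas N_meas in simp)
  also have "\<dots> \<le> prob {\<omega>\<in>space M. \<delta> < Q m \<omega>} + prob {\<omega>\<in>space M. \<epsilon> < \<bar>N m \<omega>\<bar>}"
    using Qm_meas N_meas by (intro measure_Un_le) auto
  also have "prob {\<omega>\<in>space M. \<epsilon> < \<bar>N m \<omega>\<bar>} \<le> expectation (\<lambda>\<omega>. (N m \<omega>)\<^sup>2) / \<epsilon>\<^sup>2"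
    using N_m N_meas \<open>0 < \<epsilon>\<close> by (intro prob_abs_gt_le) (auto simp: sq_int_def)
  also have "\<dots> \<le> \<delta> / \<epsilon>\<^sup>2"
    using N_le by (intro divide_right_mono) auto
  finally show ?thesis
    unfolding S_def Q_def by simp
qed

end

subsection \<open>Refinement of partitions\<close>

lemma finite_set_strict_enum:
  fixes S :: "'b::linorder set"
  assumes "finite S" "S \<noteq> {}"
  obtains m :: nat and \<sigma> where "\<And>i j. i < j \<Longrightarrow> j \<le> m \<Longrightarrow> \<sigma> i < \<sigma> j" "\<sigma> ` {..m} = S"
proof
  let ?L = "sorted_list_of_set S"
  have len: "length ?L = Suc (card S - 1)"
    using assms card_gt_0_iff[of S] by (simp del: card_gt_0_iff)
  show "?L ! i < ?L ! j" if "i < j" "j \<le> card S - 1" for i j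
    using that len by (intro sorted_wrt_nth_less[OF strict_sorted_list_of_set]) auto
  show "(!) ?L ` {..card S - 1} = S"
  proof -
    have "(!) ?L ` {..card S - 1} = set ?L"
      unfolding set_conv_nth len by (auto simp: less_Suc_eq_le)
    thus ?thesis using assms by simp
  qed
qed

text \<open>The condition \<open>\<sigma> j < y\<close> cuts the sum off at the index of the
  partition point \<open>min y (\<sigma> J)\<close>. Taking the difference of two such sums, for
  both ends of a coarse interval, selects the fine cells inside it.\<close>

lemma telescope_refine:
  fixes g :: "real \<Rightarrow> real"
  assumes strict: "\<And>i j. i < j \<Longrightarrow> j \<le> m \<Longrightarrow> \<sigma> i < \<sigma> j"
    and J: "J \<le> m" and y: "min y (\<sigma> J) \<in> \<sigma> ` {..m}"
  shows "g (min y (\<sigma> J)) - g (\<sigma> 0) = (\<Sum>j<J. (if \<sigma> j < y then 1 else 0) * (g (\<sigma> (Suc j)) - g (\<sigma> j)))"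
proof -
  have mono: "i \<le> j \<Longrightarrow> j \<le> m \<Longrightarrow> \<sigma> i \<le> \<sigma> j" for i j
    using strict[of i j] by (cases "i = j") auto
  from y obtain i where i: "i \<le> m" "min y (\<sigma> J) = \<sigma> i" by auto
  have "i \<le> J"
  proof (rule ccontr)
    assume "\<not> i \<le> J"
    hence "\<sigma> J < \<sigma> i" using i strict by auto
    thus False using i by linarith
  qed
  have iff: "\<sigma> j < y \<longleftrightarrow> j < i" if "j < J" for j
  proof
    assume "\<sigma> j < y"
    hence "\<sigma> j < \<sigma> i" using strict[OF that J] i(2)[symmetric] by simp
    thus "j < i" using mono[of i j] that J by force
  next
    assume "j < i"
    hence "\<sigma> j < \<sigma> i" using strict i by auto
    thus "\<sigma> j < y" using i(2) by linarith
  qed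
  have "(\<Sum>j<J. (if \<sigma> j < y then 1 else 0) * (g (\<sigma> (Suc j)) - g (\<sigma> j)))
      = (\<Sum>j<J. if j < i then g (\<sigma> (Suc j)) - g (\<sigma> j) else 0)"
    using iff by (intro sum.cong) auto
  also have "\<dots> = (\<Sum>j<i. g (\<sigma> (Suc j)) - g (\<sigma> j))"
    using \<open>i \<le> J\<close> by (intro sum.mono_neutral_cong_right) auto
  also have "\<dots> = g (\<sigma> i) - g (\<sigma> 0)"
    by (rule sum_lessThan_telescope)
  finally show ?thesis using i by simp
qed

text \<open>The value of the process just to the right of \<open>\<sigma> j\<close>. The process
  lives on left-open intervals, so the test at the left end of the cell is closed on the left and
  open on the right.\<close>

definition refined_height :: "(nat \<Rightarrow> real) \<Rightarrow> 'a simple_data \<Rightarrow> nat \<Rightarrow> 'a \<Rightarrow> real" where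
  "refined_height \<sigma> = (\<lambda>(n, \<tau>, \<xi>) j \<omega>. \<Sum>k<n. \<xi> k \<omega> * (if \<tau> k \<le> \<sigma> j \<and> \<sigma> j < \<tau> (Suc k) then 1 else 0))"

text \<open>Partition points are capped at \<open>T\<close> because simple data may extend beyond
  the horizon. The fine partition is strict, which discards repetitions in \<tau>.\<close>

definition refines :: "nat \<Rightarrow> (nat \<Rightarrow> real) \<Rightarrow> real \<Rightarrow> 'a simple_data \<Rightarrow> bool" where
  "refines m \<sigma> T = (\<lambda>(n, \<tau>, \<xi>). (\<forall>i j. i < j \<longrightarrow> j \<le> m \<longrightarrow> \<sigma> i < \<sigma> j) \<and> \<sigma> 0 = 0 \<and> \<sigma> m = T \<and>
     (\<forall>k\<le>n. min (\<tau> k) T \<in> \<sigma> ` {..m}))"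

lemma refines_mono:
  assumes "refines m \<sigma> T \<phi>" "i \<le> j" "j \<le> m"
  shows "\<sigma> i \<le> \<sigma> j"
  using assms by (cases "i = j") (auto simp: refines_def intro: less_imp_le split: prod.splits)

lemma simple_process_refined:
  assumes ref: "refines m \<sigma> T \<phi>" and j: "j < m" and s: "\<sigma> j < s" "s \<le> \<sigma> (Suc j)"
  shows "simple_process \<phi> s \<omega> = refined_height \<sigma> \<phi> j \<omega>"
proof -
  obtain n \<tau> \<xi> where \<phi>: "\<phi> = (n, \<tau>, \<xi>)" by (cases \<phi>) auto
  note mono = refines_mono[OF ref]
  have "s \<le> T" using s mono[of "Suc j" m] j ref by (simp add: refines_def \<phi>)
  \<comment> \<open>No point of the coarse partition lies strictly inside a cell of the fine one, so
    a comparison with \<open>s\<close> can be read off at the left end of the cell.\<close>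
  have iff: "\<tau> k < s \<longleftrightarrow> \<tau> k \<le> \<sigma> j" if "k \<le> n" for k
  proof
    assume "\<tau> k < s"
    with \<open>s \<le> T\<close> have "min (\<tau> k) T = \<tau> k" by simp
    with ref that obtain i where i: "i \<le> m" "\<tau> k = \<sigma> i" by (auto simp: refines_def \<phi>)
    have "i \<le> j"
      using \<open>\<tau> k < s\<close> s i mono[of "Suc j" i] by (cases "i \<le> j") auto
    thus "\<tau> k \<le> \<sigma> j" using i mono j by simp
  qed (use s in simp)
  show ?thesis
    unfolding simple_process_def refined_height_def \<phi>
    unfolding prod.case
  proof (intro sum.cong refl)
    fix k assume "k \<in> {..<n}"
    hence "\<tau> k < s \<longleftrightarrow> \<tau> k \<le> \<sigma> j" "s \<le> \<tau> (Suc k) \<longleftrightarrow> \<sigma> j < \<tau> (Suc k)"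
      using iff[of k] iff[of "Suc k"] by (auto simp flip: not_less)
    thus "\<xi> k \<omega> * indicator {\<tau> k<..\<tau> (Suc k)} s
        = \<xi> k \<omega> * (if \<tau> k \<le> \<sigma> j \<and> \<sigma> j < \<tau> (Suc k) then 1 else 0)"
      by (simp add: indicator_def)
  qed
qed

lemma simple_integral_refined:
  assumes ref: "refines m \<sigma> T (n, \<tau>, \<xi>)" and J: "J \<le> m"
    and mono: "\<And>k. k < n \<Longrightarrow> \<tau> k \<le> \<tau> (Suc k)"
  shows "simple_integral W (n, \<tau>, \<xi>) (\<sigma> J) \<omega>
    = (\<Sum>j<J. refined_height \<sigma> (n, \<tau>, \<xi>) j \<omega> * (W (\<sigma> (Suc j)) \<omega> - W (\<sigma> j) \<omega>))"
proof -
  have strict: "i < j \<Longrightarrow> j \<le> m \<Longrightarrow> \<sigma> i < \<sigma> j" for i j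
    using ref by (auto simp: refines_def)
  have "\<sigma> J \<le> T" using refines_mono[OF ref, of J m] J ref by (simp add: refines_def)
  have mem: "min (\<tau> k) (\<sigma> J) \<in> \<sigma> ` {..m}" if "k \<le> n" for k
  proof (cases "\<tau> k \<le> \<sigma> J")
    case True
    hence "min (\<tau> k) (\<sigma> J) = min (\<tau> k) T" using \<open>\<sigma> J \<le> T\<close> by simp
    thus ?thesis using ref that by (auto simp: refines_def)
  next
    case False
    thus ?thesis using J by (auto simp: min_def)
  qed
  have "W (min (\<tau> (Suc k)) (\<sigma> J)) \<omega> - W (min (\<tau> k) (\<sigma> J)) \<omega>
      = (\<Sum>j<J. (if \<tau> k \<le> \<sigma> j \<and> \<sigma> j < \<tau> (Suc k) then 1 else 0) * (W (\<sigma> (Suc j)) \<omega> - W (\<sigma> j) \<omega>))"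
    if k: "k < n" for k
  proof -
    let ?g = "\<lambda>x. W x \<omega>"
    \<comment> \<open>Both ends are compared with the base point \<open>\<sigma> 0\<close>; the two
      cut-off sums then subtract, and by \<open>\<tau> k \<le> \<tau> (Suc k)\<close> the difference
      of the cut-offs is again a 0-1 weight.\<close>
    have "?g (min (\<tau> (Suc k)) (\<sigma> J)) - ?g (min (\<tau> k) (\<sigma> J))
        = (?g (min (\<tau> (Suc k)) (\<sigma> J)) - ?g (\<sigma> 0)) - (?g (min (\<tau> k) (\<sigma> J)) - ?g (\<sigma> 0))" by simp
    also have "\<dots> = (\<Sum>j<J. (if \<sigma> j < \<tau> (Suc k) then 1 else 0) * (?g (\<sigma> (Suc j)) - ?g (\<sigma> j)))
        - (\<Sum>j<J. (if \<sigma> j < \<tau> k then 1 else 0) * (?g (\<sigma> (Suc j)) - ?g (\<sigma> j)))"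
      using telescope_refine[of m \<sigma> J "\<tau> (Suc k)" ?g] telescope_refine[of m \<sigma> J "\<tau> k" ?g]
        strict J mem[of k] mem[of "Suc k"] k by simp
    also have "\<dots> = (\<Sum>j<J. (if \<tau> k \<le> \<sigma> j \<and> \<sigma> j < \<tau> (Suc k) then 1 else 0) * (?g (\<sigma> (Suc j)) - ?g (\<sigma> j)))"
      unfolding sum_subtractf[symmetric] using mono[OF k] by (intro sum.cong) auto
    finally show ?thesis .
  qed
  hence "simple_integral W (n, \<tau>, \<xi>) (\<sigma> J) \<omega> = (\<Sum>k<n. \<Sum>j<J. \<xi> k \<omega> *
      ((if \<tau> k \<le> \<sigma> j \<and> \<sigma> j < \<tau> (Suc k) then 1 else 0) * (W (\<sigma> (Suc j)) \<omega> - W (\<sigma> j) \<omega>)))"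
    unfolding simple_integral_def sum_distrib_left[symmetric] by simp
  also have "\<dots> = (\<Sum>j<J. refined_height \<sigma> (n, \<tau>, \<xi>) j \<omega> * (W (\<sigma> (Suc j)) \<omega> - W (\<sigma> j) \<omega>))"
    unfolding refined_height_def by (subst sum.swap) (simp add: sum_distrib_right mult.assoc)
  finally show ?thesis .
qed

text \<open>The half-open cells are disjoint, so at each \<open>s\<close> at most one summand is
  nonzero. A pointwise comparison suffices for this direction and needs no measurability of
  \<open>f\<close>, nor its value at \<open>\<sigma> 0\<close>.\<close>

lemma step_sq_le_nn_integral:
  assumes strict: "\<And>i j. i < j \<Longrightarrow> j \<le> m \<Longrightarrow> \<sigma> i < (\<sigma> j :: real)"
    and f: "\<And>j s. j < m \<Longrightarrow> \<sigma> j < s \<Longrightarrow> s \<le> \<sigma> (Suc j) \<Longrightarrow> f s = (c j :: real)"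
  shows "ennreal (\<Sum>j<m. (c j)\<^sup>2 * (\<sigma> (Suc j) - \<sigma> j)) \<le> (\<integral>\<^sup>+s\<in>{\<sigma> 0..\<sigma> m}. ennreal ((f s)\<^sup>2) \<partial>lborel)"
proof -
  have mono: "i \<le> j \<Longrightarrow> j \<le> m \<Longrightarrow> \<sigma> i \<le> \<sigma> j" for i j
    using strict[of i j] by (cases "i = j") auto
  have "ennreal (\<Sum>j<m. (c j)\<^sup>2 * (\<sigma> (Suc j) - \<sigma> j)) = (\<Sum>j<m. ennreal ((c j)\<^sup>2 * (\<sigma> (Suc j) - \<sigma> j)))"
    using mono by (intro sum_ennreal[symmetric]) auto
  also have "\<dots> = (\<Sum>j<m. \<integral>\<^sup>+s. ennreal ((c j)\<^sup>2) * indicator {\<sigma> j<..\<sigma> (Suc j)} s \<partial>lborel)"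
    using mono by (intro sum.cong) (auto simp: nn_integral_cmult_indicator ennreal_mult)
  also have "\<dots> = (\<integral>\<^sup>+s. (\<Sum>j<m. ennreal ((c j)\<^sup>2) * indicator {\<sigma> j<..\<sigma> (Suc j)} s) \<partial>lborel)"
    by (intro nn_integral_sum[symmetric]) auto
  also have "\<dots> \<le> (\<integral>\<^sup>+s\<in>{\<sigma> 0..\<sigma> m}. ennreal ((f s)\<^sup>2) \<partial>lborel)"
  proof (rule nn_integral_mono)
    fix s
    show "(\<Sum>j<m. ennreal ((c j)\<^sup>2) * indicator {\<sigma> j<..\<sigma> (Suc j)} s) \<le> ennreal ((f s)\<^sup>2) * indicator {\<sigma> 0..\<sigma> m} s"
    proof (cases "\<exists>i<m. \<sigma> i < s \<and> s \<le> \<sigma> (Suc i)")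
      case True
      then obtain i where i: "i < m" "\<sigma> i < s" "s \<le> \<sigma> (Suc i)" by blast
      have uniq: "j = i" if "j < m" "\<sigma> j < s" "s \<le> \<sigma> (Suc j)" for j
        using mono[of "Suc i" j] mono[of "Suc j" i] i that
        by (cases i j rule: linorder_cases) auto
      have "(\<Sum>j<m. ennreal ((c j)\<^sup>2) * indicator {\<sigma> j<..\<sigma> (Suc j)} s)
          = (\<Sum>j<m. if j = i then ennreal ((c i)\<^sup>2) else 0)"
      proof (intro sum.cong refl)
        fix j assume "j \<in> {..<m}"
        hence "\<sigma> j < s \<and> s \<le> \<sigma> (Suc j) \<longleftrightarrow> j = i" using uniq[of j] i by blast
        thus "ennreal ((c j)\<^sup>2) * indicator {\<sigma> j<..\<sigma> (Suc j)} s = (if j = i then ennreal ((c i)\<^sup>2) else 0)"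
          by (simp add: indicator_def)
      qed
      also have "\<dots> = ennreal ((f s)\<^sup>2)" using i f by simp
      finally show ?thesis using i mono[of 0 i] mono[of "Suc i" m] by (auto simp: indicator_def)
    next
      case False
      hence "(\<Sum>j<m. ennreal ((c j)\<^sup>2) * indicator {\<sigma> j<..\<sigma> (Suc j)} s) = 0"
        by (intro sum.neutral) (auto simp: indicator_def)
      thus ?thesis by simp
    qed
  qed
  finally show ?thesis .
qed

abbreviation sq_dist :: "real \<Rightarrow> (real \<Rightarrow> 'a \<Rightarrow> real) \<Rightarrow> (real \<Rightarrow> 'a \<Rightarrow> real) \<Rightarrow> 'a \<Rightarrow> ennreal" where
  "sq_dist T f g \<omega> \<equiv> \<integral>\<^sup>+s\<in>{0..T}. ennreal ((f s \<omega> - g s \<omega>)\<^sup>2) \<partial>lborel"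

context brownian_filtration
begin

lemma simple_process_measurable:
  assumes "simple_data M F \<phi>"
  shows "(\<lambda>(\<omega>, s). simple_process \<phi> s \<omega>) \<in> borel_measurable (M \<Otimes>\<^sub>M borel)"
proof -
  obtain n \<tau> \<xi> where \<phi>: "\<phi> = (n, \<tau>, \<xi>)" by (cases \<phi>) auto
  have "(\<lambda>x. \<Sum>k<n. \<xi> k (fst x) * indicator {\<tau> k<..\<tau> (Suc k)} (snd x)) \<in> borel_measurable (M \<Otimes>\<^sub>M borel)"
  proof (intro borel_measurable_sum borel_measurable_times)
    fix k assume "k \<in> {..<n}"
    hence [measurable]: "\<xi> k \<in> borel_measurable M"
      using measurable_F[OF simple_dataD(3)[OF assms[unfolded \<phi>]]] by simp
    show "(\<lambda>x. \<xi> k (fst x)) \<in> borel_measurable (M \<Otimes>\<^sub>M borel)" by measurable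
    show "(\<lambda>x. indicator {\<tau> k<..\<tau> (Suc k)} (snd x) :: real) \<in> borel_measurable (M \<Otimes>\<^sub>M borel)" by measurable
  qed
  thus ?thesis by (simp add: \<phi> simple_process_def case_prod_beta)
qed

lemma sq_dist_measurable:
  fixes a b :: real
  assumes "(\<lambda>(\<omega>, s). f s \<omega>) \<in> borel_measurable (M \<Otimes>\<^sub>M borel)"
    and "(\<lambda>(\<omega>, s). g s \<omega> :: real) \<in> borel_measurable (M \<Otimes>\<^sub>M borel)"
  shows "(\<lambda>\<omega>. \<integral>\<^sup>+s\<in>{a..b}. ennreal ((f s \<omega> - g s \<omega>)\<^sup>2) \<partial>lborel) \<in> borel_measurable M"
proof -
  have [measurable]: "(\<lambda>(\<omega>, s). f s \<omega>) \<in> borel_measurable (M \<Otimes>\<^sub>M lborel)"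
    "(\<lambda>(\<omega>, s). g s \<omega>) \<in> borel_measurable (M \<Otimes>\<^sub>M lborel)"
    using assms by (auto cong: measurable_cong_sets sets_pair_measure_cong)
  show ?thesis by measurable
qed

text \<open>A summand survives only if \<open>\<tau> k \<le> \<sigma> j\<close>, so every height
  that enters is already known at time \<open>\<sigma> j\<close>.\<close>

lemma refined_height_measurable:
  assumes "simple_data M F (n, \<tau>, \<xi>)"
  shows "refined_height \<sigma> (n, \<tau>, \<xi>) j \<in> borel_measurable (F (\<sigma> j))"
proof -
  have "(\<lambda>\<omega>. \<Sum>k<n. \<xi> k \<omega> * (if \<tau> k \<le> \<sigma> j \<and> \<sigma> j < \<tau> (Suc k) then 1 else 0)) \<in> borel_measurable (F (\<sigma> j))"
  proof (rule borel_measurable_sum)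
    fix k assume "k \<in> {..<n}"
    thus "(\<lambda>\<omega>. \<xi> k \<omega> * (if \<tau> k \<le> \<sigma> j \<and> \<sigma> j < \<tau> (Suc k) then 1 else 0)) \<in> borel_measurable (F (\<sigma> j))"
      using simple_dataD(3)[OF assms, of k] by (auto intro: measurable_F_mono[of _ "\<tau> k"])
  qed
  thus ?thesis by (simp add: refined_height_def)
qed

lemma refined_height_bounded:
  assumes "simple_data M F (n, \<tau>, \<xi>)"
  shows "\<exists>B. \<forall>\<omega>\<in>space M. \<bar>refined_height \<sigma> (n, \<tau>, \<xi>) j \<omega>\<bar> \<le> B"
proof -
  have "\<forall>k\<in>{..<n}. \<exists>B. \<forall>\<omega>\<in>space M. \<bar>\<xi> k \<omega>\<bar> \<le> B" using simple_dataD(4)[OF assms] by simp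
  then obtain B where B: "\<And>k \<omega>. k < n \<Longrightarrow> \<omega> \<in> space M \<Longrightarrow> \<bar>\<xi> k \<omega>\<bar> \<le> B k"
    by (metis bchoice lessThan_iff)
  have "\<bar>refined_height \<sigma> (n, \<tau>, \<xi>) j \<omega>\<bar> \<le> (\<Sum>k<n. B k)" if "\<omega> \<in> space M" for \<omega>
  proof -
    have "\<bar>refined_height \<sigma> (n, \<tau>, \<xi>) j \<omega>\<bar>
        \<le> (\<Sum>k<n. \<bar>\<xi> k \<omega> * (if \<tau> k \<le> \<sigma> j \<and> \<sigma> j < \<tau> (Suc k) then 1 else 0)\<bar>)"
      unfolding refined_height_def by (simp only: prod.case sum_abs)
    also have "\<dots> \<le> (\<Sum>k<n. B k)"
      using B[OF _ that] by (intro sum_mono) (fastforce intro: order_trans[OF abs_ge_zero])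
    finally show ?thesis .
  qed
  thus ?thesis by blast
qed

text \<open>On a common refinement containing \<open>V\<close>, the difference of the two integrals
  is a single simple integral, and its values on \<open>V\<close> are among its partial sums. The
  resulting bound does not involve the size of \<open>V\<close>.\<close>

lemma simple_integral_diff_maximal:
  assumes \<phi>: "simple_data M F \<phi>" and \<psi>: "simple_data M F \<psi>"
    and "0 \<le> T" and V: "finite V" "V \<subseteq> {0..T}" and "0 < \<epsilon>" "0 \<le> \<delta>"
  shows "prob {\<omega>\<in>space M. \<exists>v\<in>V. \<epsilon> < \<bar>simple_integral W \<phi> v \<omega> - simple_integral W \<psi> v \<omega>\<bar>}
    \<le> prob {\<omega>\<in>space M. ennreal \<delta> <
        sq_dist T (simple_process \<phi>) (simple_process \<psi>) \<omega>} + \<delta> / \<epsilon>\<^sup>2"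
proof -
  obtain n1 \<tau>1 \<xi>1 where \<phi>_eq: "\<phi> = (n1, \<tau>1, \<xi>1)" by (cases \<phi>) auto
  obtain n2 \<tau>2 \<xi>2 where \<psi>_eq: "\<psi> = (n2, \<tau>2, \<xi>2)" by (cases \<psi>) auto
  note sd1 = \<phi>[unfolded \<phi>_eq] and sd2 = \<psi>[unfolded \<psi>_eq]
  define S where "S = {0, T} \<union> V \<union> (\<lambda>k. min (\<tau>1 k) T) ` {..n1} \<union> (\<lambda>k. min (\<tau>2 k) T) ` {..n2}"
  have "finite S" "S \<noteq> {}" using V by (auto simp: S_def)
  then obtain m :: nat and \<sigma> where strict: "\<And>i j. i < j \<Longrightarrow> j \<le> m \<Longrightarrow> \<sigma> i < \<sigma> j" and \<sigma>_im: "\<sigma> ` {..m} = S"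
    by (rule finite_set_strict_enum) blast
  have S_bd: "S \<subseteq> {0..T}"
    using \<open>0 \<le> T\<close> V simple_data_nonneg[OF sd1] simple_data_nonneg[OF sd2] by (auto simp: S_def)
  have \<sigma>_S: "\<sigma> j \<in> S" if "j \<le> m" for j using that \<sigma>_im by auto
  have mono: "i \<le> j \<Longrightarrow> j \<le> m \<Longrightarrow> \<sigma> i \<le> \<sigma> j" for i j
    using strict[of i j] by (cases "i = j")auto
  have im: "0 \<in> \<sigma> ` {..m}" "T \<in> \<sigma> ` {..m}" unfolding \<sigma>_im by (auto simp: S_def)
  have \<sigma>0: "\<sigma> 0 = 0" and \<sigma>m: "\<sigma> m = T"
  proof -
    have "\<sigma> 0 \<le> x" "x \<le> \<sigma> m" if "x \<in> \<sigma> ` {..m}" for x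
      using that mono[of 0] mono[of _ m] by auto
    moreover have "0 \<le> \<sigma> 0" "\<sigma> m \<le> T" using \<sigma>_S[of 0] \<sigma>_S[of m] S_bd by auto
    ultimately show "\<sigma> 0 = 0" "\<sigma> m = T"
      using im by (meson antisym)+
  qed
  have ref1: "refines m \<sigma> T (n1, \<tau>1, \<xi>1)" and ref2: "refines m \<sigma> T (n2, \<tau>2, \<xi>2)"
    using strict \<sigma>0 \<sigma>m unfolding refines_def \<sigma>_im by (auto simp: S_def)
  define \<zeta> where "\<zeta> j \<omega> = refined_height \<sigma> \<phi> j \<omega> - refined_height \<sigma> \<psi> j \<omega>" for j \<omega>
  have \<zeta>_bd: "\<exists>B. \<forall>\<omega>\<in>space M. \<bar>\<zeta> j \<omega>\<bar> \<le> B" for j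
  proof -
    obtain B1 B2 where "\<forall>\<omega>\<in>space M. \<bar>refined_height \<sigma> \<phi> j \<omega>\<bar> \<le> B1"
      "\<forall>\<omega>\<in>space M. \<bar>refined_height \<sigma> \<psi> j \<omega>\<bar> \<le> B2"
      using refined_height_bounded[OF sd1] refined_height_bounded[OF sd2] unfolding \<phi>_eq \<psi>_eq by blast
    hence "\<forall>\<omega>\<in>space M. \<bar>\<zeta> j \<omega>\<bar> \<le> B1 + B2"
      unfolding \<zeta>_def by (auto intro: order_trans[OF abs_triangle_ineq4 add_mono])
    thus ?thesis by blast
  qed
  have "\<zeta> j \<in> borel_measurable (F (\<sigma> j))" for j
    unfolding \<zeta>_def \<phi>_eq \<psi>_eq
    by (intro borel_measurable_diff refined_height_measurable sd1 sd2)
  hence sd: "simple_data M F (m, \<sigma>, \<zeta>)"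
    using \<sigma>0 mono \<zeta>_bd by (auto simp: simple_data_def)
  have int_eq: "simple_integral W \<phi> (\<sigma> J) \<omega> - simple_integral W \<psi> (\<sigma> J) \<omega>
      = (\<Sum>k<J. \<zeta> k \<omega> * (W (\<sigma> (Suc k)) \<omega> - W (\<sigma> k) \<omega>))" if "J \<le> m" for J \<omega>
    using simple_integral_refined[OF ref1 that simple_dataD(2)[OF sd1]]
      simple_integral_refined[OF ref2 that simple_dataD(2)[OF sd2]]
    by (simp add: \<zeta>_def \<phi>_eq \<psi>_eq sum_subtractf left_diff_distrib)
  have proc_eq: "simple_process \<phi> s \<omega> - simple_process \<psi> s \<omega> = \<zeta> j \<omega>"
    if "j < m" "\<sigma> j < s" "s \<le> \<sigma> (Suc j)" for j s \<omega>
    using simple_process_refined[OF ref1 that] simple_process_refined[OF ref2 that]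
    by (simp add: \<zeta>_def \<phi>_eq \<psi>_eq)
  have W_meas: "W (\<sigma> j) \<in> borel_measurable M" if "j \<le> m" for j
    using \<sigma>_S[OF that] S_bd by (intro measurable_W) auto
  have \<zeta>_meas: "\<zeta> j \<in> borel_measurable M" if "j < m" for j
    using simple_dataD(3)[OF sd that] by (rule measurable_F)
  have "prob {\<omega>\<in>space M. \<exists>v\<in>V. \<epsilon> < \<bar>simple_integral W \<phi> v \<omega> - simple_integral W \<psi> v \<omega>\<bar>}
      \<le> prob {\<omega>\<in>space M. \<exists>j\<le>m. \<epsilon> < \<bar>\<Sum>k<j. \<zeta> k \<omega> * (W (\<sigma> (Suc k)) \<omega> - W (\<sigma> k) \<omega>)\<bar>}"
  proof (rule finite_measure_mono)
    have "V \<subseteq> \<sigma> ` {..m}" unfolding \<sigma>_im by (auto simp: S_def)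
    thus "{\<omega>\<in>space M. \<exists>v\<in>V. \<epsilon> < \<bar>simple_integral W \<phi> v \<omega> - simple_integral W \<psi> v \<omega>\<bar>}
        \<subseteq> {\<omega>\<in>space M. \<exists>j\<le>m. \<epsilon> < \<bar>\<Sum>k<j. \<zeta> k \<omega> * (W (\<sigma> (Suc k)) \<omega> - W (\<sigma> k) \<omega>)\<bar>}"
      using int_eq by fastforce
    have "(\<lambda>\<omega>. \<Sum>k<j. \<zeta> k \<omega> * (W (\<sigma> (Suc k)) \<omega> - W (\<sigma> k) \<omega>)) \<in> borel_measurable M" if "j \<le> m" for j
      using that W_meas \<zeta>_meas
      by (intro borel_measurable_sum borel_measurable_times borel_measurable_diff) auto
    hence "(\<Union>j\<in>{..m}. {\<omega>\<in>space M. \<epsilon> < \<bar>\<Sum>k<j. \<zeta> k \<omega> * (W (\<sigma> (Suc k)) \<omega> - W (\<sigma> k) \<omega>)\<bar>}) \<in> sets M"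
      by (intro sets.finite_UN) auto
    also have "(\<Union>j\<in>{..m}. {\<omega>\<in>space M. \<epsilon> < \<bar>\<Sum>k<j. \<zeta> k \<omega> * (W (\<sigma> (Suc k)) \<omega> - W (\<sigma> k) \<omega>)\<bar>})
        = {\<omega>\<in>space M. \<exists>j\<le>m. \<epsilon> < \<bar>\<Sum>k<j. \<zeta> k \<omega> * (W (\<sigma> (Suc k)) \<omega> - W (\<sigma> k) \<omega>)\<bar>}" by auto
    finally show "{\<omega>\<in>space M. \<exists>j\<le>m. \<epsilon> < \<bar>\<Sum>k<j. \<zeta> k \<omega> * (W (\<sigma> (Suc k)) \<omega> - W (\<sigma> k) \<omega>)\<bar>} \<in> sets M" .
  qed
  also have "\<dots> \<le> prob {\<omega>\<in>space M. \<delta> < (\<Sum>k<m. (\<zeta> k \<omega>)\<^sup>2 * (\<sigma> (Suc k) - \<sigma> k))} + \<delta> / \<epsilon>\<^sup>2"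
    by (rule simple_maximal_inequality[OF sd \<open>0 < \<epsilon>\<close> \<open>0 \<le> \<delta>\<close>])
  also have "prob {\<omega>\<in>space M. \<delta> < (\<Sum>k<m. (\<zeta> k \<omega>)\<^sup>2 * (\<sigma> (Suc k) - \<sigma> k))}
      \<le> prob {\<omega>\<in>space M. ennreal \<delta> <
        sq_dist T (simple_process \<phi>) (simple_process \<psi>) \<omega>}"
  proof (rule finite_measure_mono)
    have le: "ennreal (\<Sum>k<m. (\<zeta> k \<omega>)\<^sup>2 * (\<sigma> (Suc k) - \<sigma> k))
        \<le> sq_dist T (simple_process \<phi>) (simple_process \<psi>) \<omega>" for \<omega>
      using step_sq_le_nn_integral[of m \<sigma>, OF strict, of "\<lambda>s. simple_process \<phi> s \<omega> - simple_process \<psi> s \<omega>"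
          "\<lambda>j. \<zeta> j \<omega>"] proc_eq by (simp add: \<sigma>0 \<sigma>m)
    show "{\<omega>\<in>space M. \<delta> < (\<Sum>k<m. (\<zeta> k \<omega>)\<^sup>2 * (\<sigma> (Suc k) - \<sigma> k))}
        \<subseteq> {\<omega>\<in>space M. ennreal \<delta> <
          sq_dist T (simple_process \<phi>) (simple_process \<psi>) \<omega>}"
      using \<open>0 \<le> \<delta>\<close> by (auto intro!: less_le_trans[OF _ le] simp: ennreal_less_iff)
    show "{\<omega>\<in>space M. ennreal \<delta> <
        sq_dist T (simple_process \<phi>) (simple_process \<psi>) \<omega>} \<in> sets M"
      using sq_dist_measurable[OF simple_process_measurable[OF \<phi>] simple_process_measurable[OF \<psi>]]
      by simp
  qed
  finally show ?thesis by simp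
qed

subsection \<open>Ito integrals: maximal inequality\<close>

text \<open>Progressive measurability gives joint measurability on \<open>[0,T]\<close> only, hence the time projection.\<close>

lemma progressive_projected:
  assumes "progressive F H" "0 \<le> T"
  shows "(\<lambda>(\<omega>, s). H (max 0 (min T s)) \<omega>) \<in> borel_measurable (M \<Otimes>\<^sub>M borel)"
proof -
  have H: "(\<lambda>(s, \<omega>). H s \<omega>) \<in> borel_measurable (restrict_space borel {0..T} \<Otimes>\<^sub>M F T)"
    using assms by (simp add: progressive_def)
  have "(\<lambda>x. max 0 (min T (snd x))) \<in> measurable (M \<Otimes>\<^sub>M borel) (restrict_space borel {0..T})"
    using assms(2) by (intro measurable_restrict_space2) auto
  \<comment> \<open>The identity is measurable from \<open>M\<close> to the smaller sigma-algebra
    \<open>F T\<close>.\<close>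
  moreover have "fst \<in> measurable (M \<Otimes>\<^sub>M borel) (F T)"
    using measurable_F[of "\<lambda>\<omega>. \<omega>" T "F T"] by (intro measurable_compose[OF measurable_fst]) simp
  ultimately have "(\<lambda>x. (max 0 (min T (snd x)), fst x))
      \<in> measurable (M \<Otimes>\<^sub>M borel) (restrict_space borel {0..T} \<Otimes>\<^sub>M F T)"
    by (rule measurable_Pair)
  from measurable_compose[OF this H] show ?thesis
    by (simp add: case_prod_beta)
qed

lemma sq_dist_progressive_measurable:
  assumes \<phi>: "simple_data M F \<phi>" and H: "progressive F H" and "0 \<le> T"
  shows "sq_dist T (simple_process \<phi>) H \<in> borel_measurable M"
proof -
  have "sq_dist T (simple_process \<phi>) H = sq_dist T (simple_process \<phi>) (\<lambda>s. H (max 0 (min T s)))"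
    by (intro ext nn_integral_cong) (auto simp: indicator_def)
  thus ?thesis
    using sq_dist_measurable[OF simple_process_measurable[OF \<phi>] progressive_projected[OF H \<open>0 \<le> T\<close>]]
    by simp
qed

lemma sq_dist_triangle:
  assumes \<phi>: "simple_data M F \<phi>" and \<psi>: "simple_data M F \<psi>"
    and H: "progressive F H" and "0 \<le> T" and \<omega>: "\<omega> \<in> space M"
  shows "sq_dist T (simple_process \<phi>) (simple_process \<psi>) \<omega>
    \<le> 2 * sq_dist T (simple_process \<phi>) H \<omega> + 2 * sq_dist T (simple_process \<psi>) H \<omega>"
proof -
  let ?H = "\<lambda>s. H (max 0 (min T s)) \<omega>"
  have [measurable]: "?H \<in> borel_measurable lborel"
    "(\<lambda>s. simple_process \<phi> s \<omega>) \<in> borel_measurable lborel"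
    "(\<lambda>s. simple_process \<psi> s \<omega>) \<in> borel_measurable lborel"
    using measurable_Pair2[OF progressive_projected[OF H \<open>0 \<le> T\<close>] \<omega>]
      measurable_Pair2[OF simple_process_measurable[OF \<phi>] \<omega>]
      measurable_Pair2[OF simple_process_measurable[OF \<psi>] \<omega>] by auto
  \<comment> \<open>The right side minus the left side is the square of
    \<open>x + y - 2 * z\<close>.\<close>
  have ineq: "(x - y)\<^sup>2 \<le> 2 * (x - z)\<^sup>2 + 2 * (y - z)\<^sup>2" for x y z :: real
    using zero_le_power2[of "x + y - 2 * z"] by (simp add: power2_eq_square algebra_simps)
  have "sq_dist T (simple_process \<phi>) (simple_process \<psi>) \<omega>
      \<le> (\<integral>\<^sup>+s. 2 * (ennreal ((simple_process \<phi> s \<omega> - ?H s)\<^sup>2) * indicator {0..T} s)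
        + 2 * (ennreal ((simple_process \<psi> s \<omega> - ?H s)\<^sup>2) * indicator {0..T} s) \<partial>lborel)"
  proof (rule nn_integral_mono)
    fix s
    show "ennreal ((simple_process \<phi> s \<omega> - simple_process \<psi> s \<omega>)\<^sup>2) * indicator {0..T} s
      \<le> 2 * (ennreal ((simple_process \<phi> s \<omega> - ?H s)\<^sup>2) * indicator {0..T} s)
        + 2 * (ennreal ((simple_process \<psi> s \<omega> - ?H s)\<^sup>2) * indicator {0..T} s)"
      using ennreal_leI[OF ineq[of "simple_process \<phi> s \<omega>" "simple_process \<psi> s \<omega>" "?H s"]]
      by (auto simp: indicator_def ennreal_plus ennreal_mult' max_def min_def)
  qed
  also have "\<dots> = 2 * (\<integral>\<^sup>+s\<in>{0..T}. ennreal ((simple_process \<phi> s \<omega> - ?H s)\<^sup>2) \<partial>lborel)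
      + 2 * (\<integral>\<^sup>+s\<in>{0..T}. ennreal ((simple_process \<psi> s \<omega> - ?H s)\<^sup>2) \<partial>lborel)"
    by (simp add: nn_integral_add nn_integral_cmult)
  also have "(\<integral>\<^sup>+s\<in>{0..T}. ennreal ((simple_process \<phi> s \<omega> - ?H s)\<^sup>2) \<partial>lborel)
      = sq_dist T (simple_process \<phi>) H \<omega>"
    by (intro nn_integral_cong) (auto simp: indicator_def)
  also have "(\<integral>\<^sup>+s\<in>{0..T}. ennreal ((simple_process \<psi> s \<omega> - ?H s)\<^sup>2) \<partial>lborel)
      = sq_dist T (simple_process \<psi>) H \<omega>"
    by (intro nn_integral_cong) (auto simp: indicator_def)
  finally show ?thesis .
qed

lemma simple_integral_measurable:
  assumes "simple_data M F \<phi>" "0 \<le> t"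
  shows "simple_integral W \<phi> t \<in> borel_measurable M"
proof -
  obtain n \<tau> \<xi> where \<phi>: "\<phi> = (n, \<tau>, \<xi>)" by (cases \<phi>) auto
  note sd = assms(1)[unfolded \<phi>]
  have "(\<lambda>\<omega>. \<Sum>k<n. \<xi> k \<omega> * (W (min (\<tau> (Suc k)) t) \<omega> - W (min (\<tau> k) t) \<omega>)) \<in> borel_measurable M"
    using measurable_F[OF simple_dataD(3)[OF sd]] simple_data_nonneg[OF sd] assms(2)
    by (intro borel_measurable_sum borel_measurable_times borel_measurable_diff measurable_W) auto
  thus ?thesis by (simp add: \<phi> simple_integral_def)
qed

text \<open>If both distances to \<open>H\<close> are at most \<delta>, the distance between the
  simple processes is at most \<open>2 * \<delta> + 2 * \<delta>\<close>; this is the source of the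
  4. No integral of \<open>H\<close> is mentioned, so the lemma can serve both to identify integrals
  and to estimate them.\<close>

lemma simple_integral_common_limit:
  assumes \<phi>: "simple_data M F \<phi>" and \<psi>: "simple_data M F \<psi>" and H: "progressive F H"
    and "0 \<le> T" and V: "finite V" "V \<subseteq> {0..T}" and "0 < \<epsilon>" "0 \<le> \<delta>"
  shows "prob {\<omega>\<in>space M. \<exists>v\<in>V. \<epsilon> < \<bar>simple_integral W \<phi> v \<omega> - simple_integral W \<psi> v \<omega>\<bar>}
    \<le> prob {\<omega>\<in>space M. ennreal \<delta> < sq_dist T (simple_process \<phi>) H \<omega>}
      + prob {\<omega>\<in>space M. ennreal \<delta> < sq_dist T (simple_process \<psi>) H \<omega>} + 4 * \<delta> / \<epsilon>\<^sup>2"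
proof -
  let ?A = "{\<omega>\<in>space M. ennreal \<delta> < sq_dist T (simple_process \<phi>) H \<omega>}"
  let ?B = "{\<omega>\<in>space M. ennreal \<delta> < sq_dist T (simple_process \<psi>) H \<omega>}"
  have sets: "?A \<in> sets M" "?B \<in> sets M"
    using sq_dist_progressive_measurable[OF \<phi> H \<open>0 \<le> T\<close>]
      sq_dist_progressive_measurable[OF \<psi> H \<open>0 \<le> T\<close>] by auto
  have "prob {\<omega>\<in>space M. \<exists>v\<in>V. \<epsilon> < \<bar>simple_integral W \<phi> v \<omega> - simple_integral W \<psi> v \<omega>\<bar>}
      \<le> prob {\<omega>\<in>space M. ennreal (4 * \<delta>) < sq_dist T (simple_process \<phi>) (simple_process \<psi>) \<omega>}
        + 4 * \<delta> / \<epsilon>\<^sup>2"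
    using assms by (intro simple_integral_diff_maximal) auto
  also have "prob {\<omega>\<in>space M. ennreal (4 * \<delta>) < sq_dist T (simple_process \<phi>) (simple_process \<psi>) \<omega>}
      \<le> prob (?A \<union> ?B)"
  proof (rule finite_measure_mono)
    show "{\<omega>\<in>space M. ennreal (4 * \<delta>) < sq_dist T (simple_process \<phi>) (simple_process \<psi>) \<omega>} \<subseteq> ?A \<union> ?B"
    proof (rule subsetI, rule ccontr)
      fix \<omega> assume \<omega>: "\<omega> \<in> {\<omega>\<in>space M. ennreal (4 * \<delta>) < sq_dist T (simple_process \<phi>) (simple_process \<psi>) \<omega>}"
        and "\<omega> \<notin> ?A \<union> ?B"
      hence "sq_dist T (simple_process \<phi>) H \<omega> \<le> ennreal \<delta>" "sq_dist T (simple_process \<psi>) H \<omega> \<le> ennreal \<delta>"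
        by (auto simp: not_less)
      hence "2 * sq_dist T (simple_process \<phi>) H \<omega> + 2 * sq_dist T (simple_process \<psi>) H \<omega>
          \<le> 2 * ennreal \<delta> + 2 * ennreal \<delta>"
        by (intro add_mono mult_left_mono) auto
      also have "\<dots> = ennreal (4 * \<delta>)"
        using \<open>0 \<le> \<delta>\<close> by (simp add: ennreal_mult' flip: distrib_right)
      finally have "sq_dist T (simple_process \<phi>) (simple_process \<psi>) \<omega> \<le> ennreal (4 * \<delta>)"
        using sq_dist_triangle[OF \<phi> \<psi> H \<open>0 \<le> T\<close>, of \<omega>] \<omega> by auto
      thus False using \<omega> by auto
    qed
  qed (use sets in simp)
  also have "\<dots> \<le> prob ?A + prob ?B"
    using sets by (rule measure_Un_le)
  finally show ?thesis by simp
qed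

lemma vanishes_in_probD:
  assumes "vanishes_in_prob M Z" "0 < \<epsilon>"
  shows "(\<lambda>n. prob {\<omega>\<in>space M. ennreal \<epsilon> < Z n \<omega>}) \<longlonglongrightarrow> 0"
  using assms by (simp add: vanishes_in_prob_def)

text \<open>The integral at \<open>t\<close> comes with its own approximating sequence \<psi> on
  \<open>[0,t]\<close>. Comparing \<psi> with \<phi> shows that one sequence approximating
  \<open>H\<close> on all of \<open>[0,T]\<close> yields the integrals at every earlier time,
  whatever sequences were used to define them.\<close>

lemma has_ito_integral_unique_limit:
  assumes ito: "has_ito_integral M F W H t I" and t: "0 \<le> t" "t \<le> T"
    and \<phi>: "\<And>n. simple_data M F (\<phi> n)"
    and lim: "vanishes_in_prob M (\<lambda>n. sq_dist T (simple_process (\<phi> n)) H)"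
    and "0 < \<epsilon>"
  shows "(\<lambda>n. prob {\<omega>\<in>space M. \<epsilon> < \<bar>simple_integral W (\<phi> n) t \<omega> - I \<omega>\<bar>}) \<longlonglongrightarrow> 0"
proof -
  from ito have H: "progressive F H" and I: "I \<in> borel_measurable M"
    by (auto simp: has_ito_integral_def)
  from ito obtain \<psi> where \<psi>: "\<And>n. simple_data M F (\<psi> n)"
    and \<psi>_lim: "vanishes_in_prob M (\<lambda>n. sq_dist t (simple_process (\<psi> n)) H)"
    and \<psi>_int: "vanishes_in_prob M (\<lambda>n \<omega>. ennreal \<bar>simple_integral W (\<psi> n) t \<omega> - I \<omega>\<bar>)"
    by (auto simp: has_ito_integral_def)
  note meas = simple_integral_measurable[OF \<phi> t(1)] simple_integral_measurable[OF \<psi> t(1)]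
  define P where "P n = prob {\<omega>\<in>space M. \<epsilon> < \<bar>simple_integral W (\<phi> n) t \<omega> - I \<omega>\<bar>}" for n
  have bound: "P n \<le> prob {\<omega>\<in>space M. ennreal (\<epsilon> / 2) < ennreal \<bar>simple_integral W (\<psi> n) t \<omega> - I \<omega>\<bar>}
      + (prob {\<omega>\<in>space M. ennreal \<delta> < sq_dist T (simple_process (\<phi> n)) H \<omega>}
        + prob {\<omega>\<in>space M. ennreal \<delta> < sq_dist t (simple_process (\<psi> n)) H \<omega>} + 4 * \<delta> / (\<epsilon> / 2)\<^sup>2)"
    if "0 < \<delta>" for \<delta> n
  proof -
    let ?A = "{\<omega>\<in>space M. \<epsilon> / 2 < \<bar>simple_integral W (\<psi> n) t \<omega> - I \<omega>\<bar>}"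
    let ?B = "{\<omega>\<in>space M. \<exists>v\<in>{t}. \<epsilon> / 2 < \<bar>simple_integral W (\<phi> n) v \<omega> - simple_integral W (\<psi> n) v \<omega>\<bar>}"
    have sets: "?A \<in> sets M" "?B \<in> sets M" using meas I by auto
    have "P n \<le> prob (?A \<union> ?B)"
      unfolding P_def
    proof (rule finite_measure_mono)
      show "{\<omega>\<in>space M. \<epsilon> < \<bar>simple_integral W (\<phi> n) t \<omega> - I \<omega>\<bar>} \<subseteq> ?A \<union> ?B"
      proof (rule subsetI)
        fix \<omega> assume \<omega>: "\<omega> \<in> {\<omega>\<in>space M. \<epsilon> < \<bar>simple_integral W (\<phi> n) t \<omega> - I \<omega>\<bar>}"
        hence "\<epsilon> / 2 < \<bar>simple_integral W (\<psi> n) t \<omega> - I \<omega>\<bar> \<or>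
            \<epsilon> / 2 < \<bar>simple_integral W (\<phi> n) t \<omega> - simple_integral W (\<psi> n) t \<omega>\<bar>"
          unfolding mem_Collect_eq by linarith
        with \<omega> show "\<omega> \<in> ?A \<union> ?B" by auto
      qed
    qed (use sets in simp)
    also have "\<dots> \<le> prob ?A + prob ?B" using sets by (rule measure_Un_le)
    also have "prob ?B \<le> prob {\<omega>\<in>space M. ennreal \<delta> < sq_dist t (simple_process (\<phi> n)) H \<omega>}
        + prob {\<omega>\<in>space M. ennreal \<delta> < sq_dist t (simple_process (\<psi> n)) H \<omega>} + 4 * \<delta> / (\<epsilon> / 2)\<^sup>2"
      using \<phi> \<psi> H t \<open>0 < \<epsilon>\<close> that by (intro simple_integral_common_limit) auto
    also have "prob {\<omega>\<in>space M. ennreal \<delta> < sq_dist t (simple_process (\<phi> n)) H \<omega>}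
        \<le> prob {\<omega>\<in>space M. ennreal \<delta> < sq_dist T (simple_process (\<phi> n)) H \<omega>}"
    proof (rule finite_measure_mono)
      have le: "sq_dist t (simple_process (\<phi> n)) H \<omega> \<le> sq_dist T (simple_process (\<phi> n)) H \<omega>" for \<omega>
        using t by (intro nn_integral_mono) (auto simp: indicator_def)
      show "{\<omega>\<in>space M. ennreal \<delta> < sq_dist t (simple_process (\<phi> n)) H \<omega>}
          \<subseteq> {\<omega>\<in>space M. ennreal \<delta> < sq_dist T (simple_process (\<phi> n)) H \<omega>}"
        by (auto intro: less_le_trans[OF _ le])
      show "{\<omega>\<in>space M. ennreal \<delta> < sq_dist T (simple_process (\<phi> n)) H \<omega>} \<in> sets M"
        using sq_dist_progressive_measurable[OF \<phi> H] t by auto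
    qed
    also have "?A = {\<omega>\<in>space M. ennreal (\<epsilon> / 2) < ennreal \<bar>simple_integral W (\<psi> n) t \<omega> - I \<omega>\<bar>}"
      using \<open>0 < \<epsilon>\<close> by (simp add: ennreal_less_iff)
    finally show ?thesis by simp
  qed
  have "P \<longlonglongrightarrow> 0"
  proof (rule LIMSEQ_I)
    fix r :: real assume "0 < r"
    \<comment> \<open>With \<delta> fixed, all probabilities in \<open>bound\<close> vanish as
      \<open>n\<close> grows and only \<open>4 * \<delta> / (\<epsilon> / 2)^2\<close> is left; the
      32 makes this \<open>r / 2\<close>.\<close>
    define \<delta> where "\<delta> = r * \<epsilon>\<^sup>2 / 32"
    have \<delta>: "0 < \<delta>" "4 * \<delta> / (\<epsilon> / 2)\<^sup>2 = r / 2"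
      using \<open>0 < r\<close> \<open>0 < \<epsilon>\<close> by (auto simp: \<delta>_def power_divide)
    have "(\<lambda>n. prob {\<omega>\<in>space M. ennreal (\<epsilon> / 2) < ennreal \<bar>simple_integral W (\<psi> n) t \<omega> - I \<omega>\<bar>}
      + (prob {\<omega>\<in>space M. ennreal \<delta> < sq_dist T (simple_process (\<phi> n)) H \<omega>}
        + prob {\<omega>\<in>space M. ennreal \<delta> < sq_dist t (simple_process (\<psi> n)) H \<omega>} + 4 * \<delta> / (\<epsilon> / 2)\<^sup>2))
      \<longlonglongrightarrow> 0 + (0 + 0 + r / 2)"
      unfolding \<delta>(2)
      using \<delta>(1) \<open>0 < \<epsilon>\<close>
      by (intro tendsto_add tendsto_const vanishes_in_probD[OF \<psi>_int] vanishes_in_probD[OF lim]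
          vanishes_in_probD[OF \<psi>_lim]) auto
    hence "\<forall>\<^sub>F n in sequentially. prob {\<omega>\<in>space M. ennreal (\<epsilon> / 2) < ennreal \<bar>simple_integral W (\<psi> n) t \<omega> - I \<omega>\<bar>}
      + (prob {\<omega>\<in>space M. ennreal \<delta> < sq_dist T (simple_process (\<phi> n)) H \<omega>}
        + prob {\<omega>\<in>space M. ennreal \<delta> < sq_dist t (simple_process (\<psi> n)) H \<omega>} + 4 * \<delta> / (\<epsilon> / 2)\<^sup>2) < r"
      by (rule order_tendstoD(2)) (use \<open>0 < r\<close> in simp)
    hence "\<forall>\<^sub>F n in sequentially. norm (P n - 0) < r"
    proof eventually_elim
      case (elim n)
      moreover have "0 \<le> P n" by (simp add: P_def)
      ultimately show ?case using bound[OF \<delta>(1), of n] by simp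
    qed
    thus "\<exists>no. \<forall>n\<ge>no. norm (P n - 0) < r" by (simp add: eventually_sequentially)
  qed
  thus ?thesis by (simp add: P_def[abs_def])
qed

text \<open>The integrals are replaced by those of one sequence \<open>\<phi> n\<close>, and then
  \<open>n\<close> tends to infinity. The union bound over \<open>V\<close> is applied only to the
  replacement errors, which vanish because \<open>V\<close> is finite and fixed; the part that
  remains is uniform in \<open>V\<close>, so the inequality can be used on grids whose size
  grows.\<close>

lemma ito_integral_maximal_inequality:
  assumes ito_T: "has_ito_integral M F W H T IT"
    and ito: "\<And>v. v \<in> V \<Longrightarrow> has_ito_integral M F W H v (I v)"
    and \<psi>: "simple_data M F \<psi>"
    and "0 \<le> T" and V: "finite V" "V \<subseteq> {0..T}" and "0 < \<epsilon>" "0 < \<delta>"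
  shows "prob {\<omega>\<in>space M. \<exists>v\<in>V. 2 * \<epsilon> < \<bar>I v \<omega> - simple_integral W \<psi> v \<omega>\<bar>}
    \<le> prob {\<omega>\<in>space M. ennreal \<delta> < sq_dist T (simple_process \<psi>) H \<omega>} + 4 * \<delta> / \<epsilon>\<^sup>2"
proof -
  from ito_T have H: "progressive F H" by (simp add: has_ito_integral_def)
  from ito_T obtain \<phi> where \<phi>: "\<And>n. simple_data M F (\<phi> n)"
    and lim: "vanishes_in_prob M (\<lambda>n. sq_dist T (simple_process (\<phi> n)) H)"
    by (auto simp: has_ito_integral_def)
  have I: "I v \<in> borel_measurable M" if "v \<in> V" for v
    using ito[OF that] by (simp add: has_ito_integral_def)
  have meas: "simple_integral W (\<phi> n) v \<in> borel_measurable M" "simple_integral W \<psi> v \<in> borel_measurable M"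
    if "v \<in> V" for v n
    using V that by (auto intro!: simple_integral_measurable \<phi> \<psi>)
  let ?L = "prob {\<omega>\<in>space M. \<exists>v\<in>V. 2 * \<epsilon> < \<bar>I v \<omega> - simple_integral W \<psi> v \<omega>\<bar>}"
  let ?p = "prob {\<omega>\<in>space M. ennreal \<delta> < sq_dist T (simple_process \<psi>) H \<omega>}"
  have bound: "?L \<le> (\<Sum>v\<in>V. prob {\<omega>\<in>space M. \<epsilon> < \<bar>simple_integral W (\<phi> n) v \<omega> - I v \<omega>\<bar>})
      + (prob {\<omega>\<in>space M. ennreal \<delta> < sq_dist T (simple_process (\<phi> n)) H \<omega>} + ?p + 4 * \<delta> / \<epsilon>\<^sup>2)" for n
  proof -
    let ?A = "\<lambda>v. {\<omega>\<in>space M. \<epsilon> < \<bar>simple_integral W (\<phi> n) v \<omega> - I v \<omega>\<bar>}"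
    let ?B = "\<lambda>v. {\<omega>\<in>space M. \<epsilon> < \<bar>simple_integral W (\<phi> n) v \<omega> - simple_integral W \<psi> v \<omega>\<bar>}"
    have sets: "?A v \<in> sets M" "?B v \<in> sets M" if "v \<in> V" for v
      using meas[OF that] I[OF that] by auto
    hence sets': "(\<Union>v\<in>V. ?A v) \<in> sets M" "(\<Union>v\<in>V. ?B v) \<in> sets M"
      using V by auto
    have "?L \<le> prob ((\<Union>v\<in>V. ?A v) \<union> (\<Union>v\<in>V. ?B v))"
    proof (rule finite_measure_mono)
      show "{\<omega>\<in>space M. \<exists>v\<in>V. 2 * \<epsilon> < \<bar>I v \<omega> - simple_integral W \<psi> v \<omega>\<bar>}
          \<subseteq> (\<Union>v\<in>V. ?A v) \<union> (\<Union>v\<in>V. ?B v)"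
      proof safe
        fix \<omega> v assume v: "v \<in> V" "\<omega> \<in> space M" "2 * \<epsilon> < \<bar>I v \<omega> - simple_integral W \<psi> v \<omega>\<bar>"
          and "\<omega> \<notin> (\<Union>v\<in>V. ?B v)"
        hence "\<bar>simple_integral W (\<phi> n) v \<omega> - simple_integral W \<psi> v \<omega>\<bar> \<le> \<epsilon>" by (auto simp: not_less)
        with v have "\<omega> \<in> ?A v" by auto
        with v show "\<omega> \<in> (\<Union>v\<in>V. ?A v)" by blast
      qed
    qed (use sets' in simp)
    also have "\<dots> \<le> prob (\<Union>v\<in>V. ?A v) + prob (\<Union>v\<in>V. ?B v)" using sets' by (rule measure_Un_le)
    also have "prob (\<Union>v\<in>V. ?A v) \<le> (\<Sum>v\<in>V. prob (?A v))"
      using V(1) sets by (intro measure_UNION_le) auto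
    also have "(\<Union>v\<in>V. ?B v) = {\<omega>\<in>space M. \<exists>v\<in>V. \<epsilon> < \<bar>simple_integral W (\<phi> n) v \<omega> - simple_integral W \<psi> v \<omega>\<bar>}"
      by auto
    also have "prob \<dots> \<le> prob {\<omega>\<in>space M. ennreal \<delta> < sq_dist T (simple_process (\<phi> n)) H \<omega>} + ?p + 4 * \<delta> / \<epsilon>\<^sup>2"
      using assms \<phi> H by (intro simple_integral_common_limit) auto
    finally show ?thesis by simp
  qed
  have "(\<lambda>n. (\<Sum>v\<in>V. prob {\<omega>\<in>space M. \<epsilon> < \<bar>simple_integral W (\<phi> n) v \<omega> - I v \<omega>\<bar>})
      + (prob {\<omega>\<in>space M. ennreal \<delta> < sq_dist T (simple_process (\<phi> n)) H \<omega>} + ?p + 4 * \<delta> / \<epsilon>\<^sup>2))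
      \<longlonglongrightarrow> (\<Sum>v\<in>V. 0) + (0 + ?p + 4 * \<delta> / \<epsilon>\<^sup>2)"
    using V \<open>0 < \<epsilon>\<close> \<open>0 < \<delta>\<close> lim
    by (intro tendsto_add tendsto_sum tendsto_const vanishes_in_probD
        has_ito_integral_unique_limit[OF ito _ _ \<phi> lim]) auto
  hence "?L \<le> (\<Sum>v\<in>V. 0) + (0 + ?p + 4 * \<delta> / \<epsilon>\<^sup>2)"
    using bound by (intro LIMSEQ_le_const) auto
  thus ?thesis by simp
qed

end

subsection \<open>Approximation on a uniform grid\<close>

definition grid :: "real \<Rightarrow> nat \<Rightarrow> nat \<Rightarrow> real" where
  "grid T n k = real k * (T / real n)"

definition truncate :: "real \<Rightarrow> real \<Rightarrow> real" where
  "truncate L y = max (- L) (min L y)"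

lemma abs_truncate_le: "0 \<le> L \<Longrightarrow> \<bar>truncate L y\<bar> \<le> L"
  by (auto simp: truncate_def)

lemma truncate_eq: "\<bar>y\<bar> \<le> L \<Longrightarrow> truncate L y = y"
  by (auto simp: truncate_def)

lemma truncate_measurable [measurable]: "truncate L \<in> borel_measurable borel"
  unfolding truncate_def[abs_def] by measurable

lemma grid_0 [simp]: "grid T n 0 = 0"
  by (simp add: grid_def)

lemma grid_nonneg: "0 \<le> T \<Longrightarrow> 0 \<le> grid T n k"
  by (simp add: grid_def)

lemma grid_mono: "0 \<le> T \<Longrightarrow> j \<le> k \<Longrightarrow> grid T n j \<le> grid T n k"
  unfolding grid_def by (intro mult_right_mono) auto

lemma grid_n: "0 < n \<Longrightarrow> grid T n n = T"
  by (simp add: grid_def)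

lemma grid_le: "0 \<le> T \<Longrightarrow> k \<le> n \<Longrightarrow> grid T n k \<le> T"
  \<comment> \<open>For \<open>n = 0\<close> division by zero makes every grid point 0.\<close>
  using grid_mono[of T k n n] grid_n[of n T] by (cases "n = 0") auto

lemma grid_Suc_diff: "grid T n (Suc k) - grid T n k = T / real n"
  by (simp add: grid_def add_divide_distrib distrib_right)

lemma grid_cell:
  assumes "0 < T" "0 < n" "0 < s" "s \<le> T"
  obtains j where "j < n" "grid T n j < s" "s \<le> grid T n (Suc j)"
proof -
  define j where "j = (LEAST j. s \<le> grid T n (Suc j))"
  obtain m where m: "n = Suc m" using assms(2) by (cases n) auto
  have ex: "s \<le> grid T n (Suc m)" using assms grid_n[of n T] by (simp add: m)
  have j: "s \<le> grid T n (Suc j)" unfolding j_def by (rule LeastI[of _ m]) (rule ex)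
  have "j \<le> m" unfolding j_def by (rule Least_le) (rule ex)
  moreover have "grid T n j < s"
  proof (cases j)
    case (Suc i)
    hence "\<not> s \<le> grid T n (Suc i)" unfolding j_def by (intro not_less_Least) simp
    thus ?thesis by (simp add: Suc)
  qed (use assms in simp)
  ultimately show ?thesis using j m that[of j] by simp
qed

lemma eventually_grid_approximation:
  fixes f :: "real \<Rightarrow> real"
  assumes f: "continuous_on {0..T} f" and "0 < T" "0 < \<eta>"
  shows "\<forall>\<^sub>F n in sequentially. 0 < n \<and> (\<forall>k\<le>n. \<bar>f (grid T n k)\<bar> \<le> real n) \<and>
    (\<forall>k<n. \<forall>s\<in>{grid T n k..grid T n (Suc k)}. \<bar>f (grid T n k) - f s\<bar> \<le> \<eta>)"
proof -
  have "bounded (f ` {0..T})"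
    using compact_continuous_image[OF f] by (simp add: compact_imp_bounded)
  then obtain B where B: "\<And>s. s \<in> {0..T} \<Longrightarrow> \<bar>f s\<bar> \<le> B"
    unfolding bounded_iff by force
  have "uniformly_continuous_on {0..T} f"
    using f by (intro compact_uniformly_continuous) auto
  then obtain d where "0 < d"
    and d: "\<And>s s'. s \<in> {0..T} \<Longrightarrow> s' \<in> {0..T} \<Longrightarrow> dist s' s < d \<Longrightarrow> dist (f s') (f s) < \<eta>"
    using \<open>0 < \<eta>\<close> unfolding uniformly_continuous_on_def by metis
  \<comment> \<open>Exceeding \<open>B\<close> makes truncation at level \<open>n\<close> inactive
    along the path; exceeding \<open>T / d\<close> makes the mesh finer than the modulus of uniform
    continuity.\<close>
  have "\<forall>\<^sub>F n in sequentially. max B (T / d) < real n"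
    using filterlim_real_sequentially unfolding filterlim_at_top_dense by blast
  thus ?thesis
  proof eventually_elim
    case (elim n)
    have "0 < T / d" using \<open>0 < T\<close> \<open>0 < d\<close> by simp
    hence n: "0 < n" using elim by (cases n) auto
    have h: "T / real n < d" using elim n \<open>0 < d\<close> by (simp add: field_simps)
    have cell: "\<bar>f (grid T n k) - f s\<bar> \<le> \<eta>"
      if k: "k < n" and s: "s \<in> {grid T n k..grid T n (Suc k)}" for k s
    proof -
      have "s \<in> {0..T}" "grid T n k \<in> {0..T}"
        using s k grid_nonneg[of T n k] grid_le[of T "Suc k" n] grid_le[of T k n] \<open>0 < T\<close> by auto
      moreover have "dist (grid T n k) s < d"
        using s h grid_Suc_diff[of T n k] by (auto simp: dist_real_def)
      ultimately show ?thesis using d[of s "grid T n k"] by (simp add: dist_real_def)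
    qed
    have "\<bar>f (grid T n k)\<bar> \<le> real n" if "k \<le> n" for k
      using B[of "grid T n k"] elim grid_nonneg[of T n k] grid_le[of T k n] \<open>0 < T\<close> that by auto
    with n cell show ?case by blast
  qed
qed

lemma grid_integral_error:
  fixes f :: "real \<Rightarrow> real"
  assumes f: "continuous_on {0..T} f" and "0 < T" and "k \<le> n"
    and osc: "\<And>k s. k < n \<Longrightarrow> s \<in> {grid T n k..grid T n (Suc k)} \<Longrightarrow> \<bar>f (grid T n k) - f s\<bar> \<le> \<eta>"
  shows "\<bar>(LINT s:{0..grid T n k}|lborel. f s) - (\<Sum>j<k. f (grid T n j) * (T / real n))\<bar> \<le> \<eta> * grid T n k"
proof -
  have cont: "continuous_on {a..b} f" if "0 \<le> a" "b \<le> T" for a b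
    using f that by (auto intro: continuous_on_subset)
  have "\<bar>integral {0..grid T n k} f - (\<Sum>j<k. f (grid T n j) * (T / real n))\<bar> \<le> \<eta> * grid T n k"
    using \<open>k \<le> n\<close>
  proof (induction k)
    case (Suc k)
    let ?t = "grid T n k" and ?t' = "grid T n (Suc k)"
    have t: "0 \<le> ?t" "?t \<le> ?t'" "?t' \<le> T"
      using Suc.prems \<open>0 < T\<close> grid_nonneg[of T n k] grid_mono[of T k "Suc k" n] grid_le[of T "Suc k" n]
      by auto
    have "norm (integral {?t..?t'} (\<lambda>s. f s - f ?t)) \<le> \<eta> * (?t' - ?t)"
      using t Suc.prems osc[of k]
      by (intro integral_bound continuous_intros cont) (auto simp: abs_minus_commute)
    also have "integral {?t..?t'} (\<lambda>s. f s - f ?t) = integral {?t..?t'} f - f ?t * (T / real n)"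
      using t cont[of ?t ?t'] grid_Suc_diff[of T n k]
      by (subst Henstock_Kurzweil_Integration.integral_diff)
         (auto intro: integrable_continuous_real)
    finally have "\<bar>integral {?t..?t'} f - f ?t * (T / real n)\<bar> \<le> \<eta> * (?t' - ?t)" by simp
    moreover have "integral {0..?t'} f = integral {0..?t} f + integral {?t..?t'} f"
      using t by (intro Henstock_Kurzweil_Integration.integral_combine[symmetric]
          integrable_continuous_real cont) auto
    ultimately show ?case using Suc by (simp add: algebra_simps)
  qed simp
  moreover have "(LINT s:{0..grid T n k}|lborel. f s) = integral {0..grid T n k} f"
    using grid_le[of T k n] \<open>0 < T\<close> \<open>k \<le> n\<close>
    by (intro set_borel_integral_eq_integral borel_integrable_atLeastAtMost' cont) auto
  ultimately show ?thesis by simp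
qed

text \<open>Dominated convergence for indicators. It turns pathwise statements, whose threshold for
  \<open>n\<close> depends on the path, into statements about probabilities.\<close>

lemma (in prob_space) prob_tendsto_0_AE_eventually:
  assumes A: "\<And>n. A n \<in> sets M" and ev: "AE \<omega> in M. \<forall>\<^sub>F n in sequentially. \<omega> \<notin> A n"
  shows "(\<lambda>n. prob (A n)) \<longlonglongrightarrow> 0"
proof -
  have "(\<lambda>n. expectation (\<lambda>\<omega>. indicator (A n) \<omega> :: real)) \<longlonglongrightarrow> expectation (\<lambda>\<omega>. 0)"
  proof (rule integral_dominated_convergence[where w="\<lambda>_. 1"])
    show "AE \<omega> in M. (\<lambda>n. indicator (A n) \<omega> :: real) \<longlonglongrightarrow> 0"
      using ev
    proof eventually_elim
      case (elim \<omega>)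
      hence "\<forall>\<^sub>F n in sequentially. indicator (A n) \<omega> = (0::real)"
        by eventually_elim simp
      thus ?case by (rule tendsto_eventually)
    qed
  qed (use A in \<open>auto simp: indicator_def\<close>)
  thus ?thesis using A by (simp add: Int_absorb1 sets.sets_into_space)
qed

text \<open>
  Truncating at level \<open>n\<close> keeps the heights bounded, as simple data require; along a continuous path it
  has no effect once \<open>n\<close> is large.
\<close>

definition grid_data :: "real \<Rightarrow> (real \<Rightarrow> 'a \<Rightarrow> real) \<Rightarrow> real \<Rightarrow> nat \<Rightarrow> 'a simple_data" where
  "grid_data a Y T n = (n, grid T n, \<lambda>k \<omega>. - a * truncate (real n) (Y (grid T n k) \<omega>))"

lemma simple_process_grid:
  assumes "0 < T" "0 < n" "j < n" "grid T n j < s" "s \<le> grid T n (Suc j)"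
  shows "simple_process (grid_data a Y T n) s \<omega> = - a * truncate (real n) (Y (grid T n j) \<omega>)"
proof -
  have "grid T n k < s \<and> s \<le> grid T n (Suc k) \<longleftrightarrow> k = j" for k
    using assms grid_mono[of T "Suc j" k n] grid_mono[of T "Suc k" j n]
    by (cases k j rule: linorder_cases) auto
  hence "simple_process (grid_data a Y T n) s \<omega>
      = (\<Sum>k<n. if k = j then - a * truncate (real n) (Y (grid T n j) \<omega>) else 0)"
    unfolding simple_process_def grid_data_def prod.case
    by (intro sum.cong) (auto simp: indicator_def)
  thus ?thesis using assms(3) by simp
qed

lemma simple_integral_grid:
  assumes "0 < T" "k \<le> n"
  shows "simple_integral W (grid_data a Y T n) (grid T n k) \<omega>
    = (\<Sum>j<k. - a * truncate (real n) (Y (grid T n j) \<omega>) * (W (grid T n (Suc j)) \<omega> - W (grid T n j) \<omega>))"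
  unfolding simple_integral_def grid_data_def prod.case
proof (rule sum.mono_neutral_cong_right)
  show "\<forall>i\<in>{..<n} - {..<k}. - a * truncate (real n) (Y (grid T n i) \<omega>) *
      (W (min (grid T n (Suc i)) (grid T n k)) \<omega> - W (min (grid T n i) (grid T n k)) \<omega>) = 0"
  proof
    fix i assume "i \<in> {..<n} - {..<k}"
    hence "grid T n k \<le> grid T n i" "grid T n k \<le> grid T n (Suc i)"
      using assms(1) by (auto intro!: grid_mono)
    thus "- a * truncate (real n) (Y (grid T n i) \<omega>) *
      (W (min (grid T n (Suc i)) (grid T n k)) \<omega> - W (min (grid T n i) (grid T n k)) \<omega>) = 0"
      by (simp add: min_def)
  qed
next
  fix i assume "i \<in> {..<k}"
  hence "grid T n i \<le> grid T n k" "grid T n (Suc i) \<le> grid T n k"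
    using assms(1) by (auto intro!: grid_mono)
  thus "- a * truncate (real n) (Y (grid T n i) \<omega>) *
      (W (min (grid T n (Suc i)) (grid T n k)) \<omega> - W (min (grid T n i) (grid T n k)) \<omega>)
    = - a * truncate (real n) (Y (grid T n i) \<omega>) * (W (grid T n (Suc i)) \<omega> - W (grid T n i) \<omega>)"
    by simp
qed (use assms in auto)

lemma grid_sq_dist_le:
  assumes "0 < T" "0 < n"
    and bd: "\<And>k. k \<le> n \<Longrightarrow> \<bar>Y (grid T n k) \<omega>\<bar> \<le> real n"
    and osc: "\<And>k s. k < n \<Longrightarrow> s \<in> {grid T n k..grid T n (Suc k)} \<Longrightarrow> \<bar>Y (grid T n k) \<omega> - Y s \<omega>\<bar> \<le> \<eta>"
  shows "sq_dist T (simple_process (grid_data a Y T n)) (\<lambda>s \<omega>. - a * Y s \<omega>) \<omega> \<le> ennreal ((a * \<eta>)\<^sup>2 * T)"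
proof -
  have "0 \<le> \<eta>" using osc[of 0 0] assms(1,2) grid_nonneg[of T n 1] by force
  have "sq_dist T (simple_process (grid_data a Y T n)) (\<lambda>s \<omega>. - a * Y s \<omega>) \<omega>
      \<le> (\<integral>\<^sup>+s. ennreal ((a * \<eta>)\<^sup>2) * indicator {0..T} s \<partial>lborel)"
  proof (rule nn_integral_mono_AE)
    \<comment> \<open>The cells of the simple process are open on the left, so it is 0 at time 0,
      where \<open>Y\<close> need not be small.\<close>
    have "AE s in lborel. s \<noteq> (0::real)" by (rule AE_lborel_singleton)
    thus "AE s in lborel. ennreal ((simple_process (grid_data a Y T n) s \<omega> - - a * Y s \<omega>)\<^sup>2) * indicator {0..T} s
        \<le> ennreal ((a * \<eta>)\<^sup>2) * indicator {0..T} s"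
    proof eventually_elim
      case (elim s)
      show ?case
      proof (cases "s \<in> {0..T}")
        case True
        with elim have "0 < s" "s \<le> T" by auto
        then obtain j where j: "j < n" "grid T n j < s" "s \<le> grid T n (Suc j)"
          using grid_cell assms(1,2) by metis
        have "simple_process (grid_data a Y T n) s \<omega> = - a * Y (grid T n j) \<omega>"
          using simple_process_grid[OF assms(1,2) j, of a Y \<omega>] bd[of j] j(1) by (simp add: truncate_eq)
        hence "simple_process (grid_data a Y T n) s \<omega> - - a * Y s \<omega> = a * (Y s \<omega> - Y (grid T n j) \<omega>)"
          by (simp add: algebra_simps)
        moreover have "(a * (Y s \<omega> - Y (grid T n j) \<omega>))\<^sup>2 \<le> (a * \<eta>)\<^sup>2"
          using osc[OF j(1), of s] j \<open>0 \<le> \<eta>\<close>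
          by (auto simp: abs_mult abs_minus_commute simp flip: abs_le_square_iff intro!: mult_left_mono)
        ultimately show ?thesis by (auto intro!: mult_right_mono ennreal_leI)
      qed simp
    qed
  qed
  also have "\<dots> = ennreal ((a * \<eta>)\<^sup>2 * T)"
    using assms(1) by (simp add: nn_integral_cmult_indicator ennreal_mult)
  finally show ?thesis .
qed

text \<open>Here \<open>x\<close> stands for the scheme and \<open>y\<close> for its perturbation;
  the left side is the conditional second moment after one step. The constant \<open>K\<close>
  collects \<open>2 * \<bar>a\<bar>\<close> from the drift, \<open>\<bar>a\<bar>\<close> from the
  mixed term and twice \<open>2 * a^2\<close> from the two squares, with \<open>h^2 \<le> h\<close>.
  It may be crude, since \<epsilon> will be chosen after \<open>K\<close>.\<close>

lemma euler_error_growth: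
  fixes a :: real
  assumes h: "0 \<le> h" "h \<le> 1" and "\<bar>y\<bar> \<le> \<epsilon>" "0 < \<epsilon>"
  defines "K \<equiv> 3 * \<bar>a\<bar> + 4 * a\<^sup>2"
  shows "((1 - a * h) * x + (- a * h) * y)\<^sup>2 + h * (- a * x + (- a) * y)\<^sup>2
    \<le> (1 + K * h) * x\<^sup>2 + K * h * \<epsilon>\<^sup>2"
proof -
  have y: "y\<^sup>2 \<le> \<epsilon>\<^sup>2" using assms(3) \<open>0 < \<epsilon>\<close> by (simp flip: abs_le_square_iff)
  have xy: "2 * \<bar>x * y\<bar> \<le> x\<^sup>2 + y\<^sup>2"
    using sum_squares_bound[of "\<bar>x\<bar>" "\<bar>y\<bar>"] by (simp add: abs_mult)
  have hh: "h\<^sup>2 \<le> h" using mult_left_le[OF h(2,1)] unfolding power2_eq_square .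
  have "((1 - a * h) * x + (- a * h) * y)\<^sup>2 + h * (- a * x + (- a) * y)\<^sup>2
      = x\<^sup>2 - 2 * a * h * x\<^sup>2 - 2 * a * h * (x * y) + a\<^sup>2 * h\<^sup>2 * (x + y)\<^sup>2 + a\<^sup>2 * h * (x + y)\<^sup>2"
    by (simp add: power2_eq_square algebra_simps)
  also have "\<dots> \<le> x\<^sup>2 + 2 * \<bar>a\<bar> * h * x\<^sup>2 + \<bar>a\<bar> * h * (x\<^sup>2 + y\<^sup>2)
      + a\<^sup>2 * h * (2 * (x\<^sup>2 + y\<^sup>2)) + a\<^sup>2 * h * (2 * (x\<^sup>2 + y\<^sup>2))"
  proof -
    have "- 2 * a * h * x\<^sup>2 \<le> 2 * \<bar>a\<bar> * h * x\<^sup>2"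
      using h by (intro mult_right_mono) auto
    moreover have "- 2 * a * h * (x * y) \<le> \<bar>a\<bar> * h * (x\<^sup>2 + y\<^sup>2)"
    proof -
      have "- 2 * a * h * (x * y) \<le> \<bar>- 2 * a * h * (x * y)\<bar>" by (rule abs_ge_self)
      also have "\<dots> = \<bar>a\<bar> * h * (2 * \<bar>x * y\<bar>)" using h by (simp add: abs_mult)
      also have "\<dots> \<le> \<bar>a\<bar> * h * (x\<^sup>2 + y\<^sup>2)" using xy h by (intro mult_left_mono) auto
      finally show ?thesis .
    qed
    moreover have sq: "(x + y)\<^sup>2 \<le> 2 * (x\<^sup>2 + y\<^sup>2)"
      using xy by (simp add: power2_sum)
    moreover have "a\<^sup>2 * h\<^sup>2 * (x + y)\<^sup>2 \<le> a\<^sup>2 * h * (2 * (x\<^sup>2 + y\<^sup>2))"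
      using sq hh h by (intro mult_mono mult_left_mono) auto
    moreover have "a\<^sup>2 * h * (x + y)\<^sup>2 \<le> a\<^sup>2 * h * (2 * (x\<^sup>2 + y\<^sup>2))"
      using sq h by (intro mult_left_mono) auto
    ultimately show ?thesis by linarith
  qed
  also have "\<dots> = (1 + K * h) * x\<^sup>2 + (\<bar>a\<bar> + 4 * a\<^sup>2) * h * y\<^sup>2"
    by (simp add: K_def algebra_simps)
  also have "\<dots> \<le> (1 + K * h) * x\<^sup>2 + K * h * \<epsilon>\<^sup>2"
    using y h by (intro add_left_mono mult_mono) (auto simp: K_def)
  finally show ?thesis .
qed

section \<open>The residual of the Euler recursion, and the scheme itself\<close>

context brownian_filtration
begin

text \<open>The defect is accumulated from time 0 rather than taken per step: the maximal inequality
  controls integrals over \<open>[0,t]\<close> uniformly in \<open>t\<close>, whereas small defects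
  of single steps could add up over \<open>n\<close> steps.\<close>

definition residual :: "real \<Rightarrow> (real \<Rightarrow> 'a \<Rightarrow> real) \<Rightarrow> real \<Rightarrow> nat \<Rightarrow> nat \<Rightarrow> 'a \<Rightarrow> real" where
  "residual a Y T n k \<omega> = Y (grid T n k) \<omega> - Y 0 \<omega> -
     (\<Sum>j<k. - a * truncate (real n) (Y (grid T n j) \<omega>) *
        (T / real n + (W (grid T n (Suc j)) \<omega> - W (grid T n j) \<omega>)))"

lemma residual_measurable:
  assumes "adapted F Y" "0 \<le> T"
  shows "residual a Y T n k \<in> borel_measurable (F (grid T n k))"
proof -
  have Y: "Y (grid T n j) \<in> borel_measurable (F (grid T n k))" if "j \<le> k" for j
    using assms grid_nonneg[of T n j] grid_mono[of T j k n] that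
    by (auto simp: adapted_def intro: measurable_F_mono[of _ "grid T n j"])
  have W: "W (grid T n j) \<in> borel_measurable (F (grid T n k))" if "j \<le> k" for j
    using assms grid_nonneg[of T n j] grid_mono[of T j k n] that
    by (auto intro: measurable_F_mono[of _ "grid T n j"] measurable_W_F)
  have T: "(\<lambda>\<omega>. truncate (real n) (Y (grid T n j) \<omega>)) \<in> borel_measurable (F (grid T n k))" if "j \<le> k" for j
    using Y[OF that] by measurable
  show ?thesis
    unfolding residual_def[abs_def]
    using Y[of k] Y[of 0] W T
    by (intro borel_measurable_diff borel_measurable_sum borel_measurable_times borel_measurable_add
        borel_measurable_const) auto
qed

lemma simple_data_grid:
  assumes "adapted F Y" "0 \<le> T"
  shows "simple_data M F (grid_data a Y T n)"
  unfolding simple_data_def grid_data_def prod.case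
proof (intro conjI allI impI)
  fix k
  have [measurable]: "Y (grid T n k) \<in> borel_measurable (F (grid T n k))"
    using assms grid_nonneg[of T n k] by (simp add: adapted_def)
  show "(\<lambda>\<omega>. - a * truncate (real n) (Y (grid T n k) \<omega>)) \<in> borel_measurable (F (grid T n k))"
    by measurable
  have "\<bar>- a * truncate (real n) (Y (grid T n k) \<omega>)\<bar> \<le> \<bar>a\<bar> * real n" for \<omega>
    using abs_truncate_le[of "real n" "Y (grid T n k) \<omega>"] by (auto simp: abs_mult intro: mult_left_mono)
  thus "\<exists>B. \<forall>\<omega>\<in>space M. \<bar>- a * truncate (real n) (Y (grid T n k) \<omega>)\<bar> \<le> B" by blast
qed (use assms grid_mono in auto)

text \<open>Where the truncation is inactive, the residual is the error of a Riemann sum for the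
  drift plus the error of the simple integral. The first tends to zero along each continuous path
  (event \<open>G\<close>). The second is handled by the maximal inequality (event
  \<open>C\<close>), whose input, the distance of the integrands (event \<open>D\<close>), is again
  a pathwise matter.\<close>

lemma residual_uniformly_small:
  assumes eq: "state_equation M F W (\<lambda>t \<omega>. - a * Y t \<omega>) Y" and "0 < T" "0 < \<epsilon>"
  shows "(\<lambda>n. prob {\<omega>\<in>space M. \<exists>k\<le>n. real n < \<bar>Y (grid T n k) \<omega>\<bar> \<or> \<epsilon> < \<bar>residual a Y T n k \<omega>\<bar>})
    \<longlonglongrightarrow> 0"
proof -
  let ?u = "\<lambda>t \<omega>. - a * Y t \<omega>"
  let ?\<psi> = "grid_data a Y T"
  let ?g = "grid T"
  from eq have Y: "adapted F Y" and cont: "continuous_paths M Y" and u: "progressive F ?u"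
    by (auto simp: state_equation_def)
  have "\<forall>t. \<exists>I. 0 \<le> t \<longrightarrow> has_ito_integral M F W ?u t I \<and>
      (AE \<omega> in M. Y t \<omega> = Y 0 \<omega> + (LINT s:{0..t}|lborel. ?u s \<omega>) + I \<omega>)"
    using eq by (auto simp: state_equation_def)
  from choice[OF this] obtain I where I: "\<And>t. 0 \<le> t \<Longrightarrow> has_ito_integral M F W ?u t (I t)"
    and sol: "\<And>t. 0 \<le> t \<Longrightarrow> AE \<omega> in M. Y t \<omega> = Y 0 \<omega> + (LINT s:{0..t}|lborel. ?u s \<omega>) + I t \<omega>"
    by blast
  have \<psi>: "simple_data M F (?\<psi> n)" for n using simple_data_grid[OF Y] \<open>0 < T\<close> by simp
  have g_nn: "0 \<le> ?g n k" for n k using grid_nonneg \<open>0 < T\<close> by simp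
  define G where "G n = (\<Union>k\<in>{..n}. {\<omega>\<in>space M. real n < \<bar>Y (?g n k) \<omega>\<bar> \<or> \<epsilon> / 2 <
    \<bar>residual a Y T n k \<omega> - (I (?g n k) \<omega> - simple_integral W (?\<psi> n) (?g n k) \<omega>)\<bar>})" for n
  define D where "D \<delta> n = {\<omega>\<in>space M. ennreal \<delta> < sq_dist T (simple_process (?\<psi> n)) ?u \<omega>}" for \<delta> n
  define C where "C n = {\<omega>\<in>space M. \<exists>v\<in>?g n ` {..n}. 2 * (\<epsilon> / 4) <
    \<bar>I v \<omega> - simple_integral W (?\<psi> n) v \<omega>\<bar>}" for n
  define B where "B n = {\<omega>\<in>space M. \<exists>k\<le>n. real n < \<bar>Y (?g n k) \<omega>\<bar> \<or> \<epsilon> < \<bar>residual a Y T n k \<omega>\<bar>}" for n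
  have Y_M: "Y (?g n k) \<in> borel_measurable M" for n k
    using Y g_nn[of n k] by (intro measurable_F[of _ "?g n k"]) (simp add: adapted_def)
  have R_M: "residual a Y T n k \<in> borel_measurable M" for n k
    using residual_measurable[OF Y] \<open>0 < T\<close> by (intro measurable_F[of _ "?g n k"]) simp
  have I_M: "I (?g n k) \<in> borel_measurable M" for n k
    using I[OF g_nn[of n k]] by (simp add: has_ito_integral_def)
  have S_M: "simple_integral W (?\<psi> n) (?g n k) \<in> borel_measurable M" for n k
    by (rule simple_integral_measurable[OF \<psi> g_nn])
  note [measurable] = Y_M R_M I_M S_M
  have G_sets: "G n \<in> sets M" for n unfolding G_def by measurable
  have C_sets: "C n \<in> sets M" for n
  proof -
    have "C n = (\<Union>k\<in>{..n}. {\<omega>\<in>space M. 2 * (\<epsilon> / 4) <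
        \<bar>I (?g n k) \<omega> - simple_integral W (?\<psi> n) (?g n k) \<omega>\<bar>})" by (auto simp: C_def)
    also have "\<dots> \<in> sets M" by measurable
    finally show ?thesis .
  qed
  have D_sets: "D \<delta> n \<in> sets M" for \<delta> n
    unfolding D_def using sq_dist_progressive_measurable[OF \<psi> u] \<open>0 < T\<close> by simp
  \<comment> \<open>The equation holds almost surely for each time separately; there are only
    countably many grid times, so one null set serves them all.\<close>
  have "AE \<omega> in M. \<forall>n k. Y (?g n k) \<omega> = Y 0 \<omega> + (LINT s:{0..?g n k}|lborel. ?u s \<omega>) + I (?g n k) \<omega>"
    using sol[OF g_nn] by (simp add: AE_all_countable)
  with cont have good: "AE \<omega> in M. continuous_on {0..T} (\<lambda>t. Y t \<omega>) \<and>
      (\<forall>n k. Y (?g n k) \<omega> = Y 0 \<omega> + (LINT s:{0..?g n k}|lborel. ?u s \<omega>) + I (?g n k) \<omega>)"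
    unfolding continuous_paths_def by eventually_elim (auto intro: continuous_on_subset)
  have "AE \<omega> in M. \<forall>\<^sub>F n in sequentially. \<omega> \<notin> G n"
    using good
  proof eventually_elim
    case (elim \<omega>)
    \<comment> \<open>Adding 1 avoids a division by zero when \<open>a = 0\<close>.\<close>
    define A where "A = \<bar>a\<bar> + 1"
    define \<eta> where "\<eta> = \<epsilon> / (2 * A * T)"
    have "0 < A" "\<bar>a\<bar> \<le> A" by (auto simp: A_def)
    hence "0 < \<eta>" using \<open>0 < \<epsilon>\<close> \<open>0 < T\<close> by (simp add: \<eta>_def)
    hence "\<bar>a\<bar> * \<eta> * T \<le> A * \<eta> * T"
      using \<open>\<bar>a\<bar> \<le> A\<close> \<open>0 < T\<close> by (intro mult_right_mono) auto
    also have "\<dots> = \<epsilon> / 2" using \<open>0 < T\<close> \<open>0 < A\<close> by (simp add: \<eta>_def)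
    finally have \<eta>: "\<bar>a\<bar> * \<eta> * T \<le> \<epsilon> / 2" .
    from elim have c: "continuous_on {0..T} (\<lambda>t. Y t \<omega>)" by simp
    from eventually_grid_approximation[OF c \<open>0 < T\<close> \<open>0 < \<eta>\<close>] show ?case
    proof eventually_elim
      case (elim n)
      hence n: "0 < n" and bd: "\<And>k. k \<le> n \<Longrightarrow> \<bar>Y (?g n k) \<omega>\<bar> \<le> real n"
        and osc: "\<And>k s. k < n \<Longrightarrow> s \<in> {?g n k..?g n (Suc k)} \<Longrightarrow> \<bar>Y (?g n k) \<omega> - Y s \<omega>\<bar> \<le> \<eta>" by auto
      have "\<bar>residual a Y T n k \<omega> - (I (?g n k) \<omega> - simple_integral W (?\<psi> n) (?g n k) \<omega>)\<bar> \<le> \<epsilon> / 2"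
        if k: "k \<le> n" for k
      proof -
        let ?J = "LINT s:{0..?g n k}|lborel. Y s \<omega>"
        have "(\<Sum>j<k. - a * truncate (real n) (Y (?g n j) \<omega>) *
              (T / real n + (W (?g n (Suc j)) \<omega> - W (?g n j) \<omega>)))
            = (\<Sum>j<k. - a * Y (?g n j) \<omega> * (T / real n))
            + (\<Sum>j<k. - a * Y (?g n j) \<omega> * (W (?g n (Suc j)) \<omega> - W (?g n j) \<omega>))"
          unfolding sum.distrib[symmetric] using bd k
          by (intro sum.cong) (auto simp: truncate_eq distrib_left)
        hence "residual a Y T n k \<omega> = Y (?g n k) \<omega> - Y 0 \<omega>
            - (\<Sum>j<k. - a * Y (?g n j) \<omega> * (T / real n))
            - (\<Sum>j<k. - a * Y (?g n j) \<omega> * (W (?g n (Suc j)) \<omega> - W (?g n j) \<omega>))"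
          unfolding residual_def by linarith
        moreover have "simple_integral W (?\<psi> n) (?g n k) \<omega>
            = (\<Sum>j<k. - a * Y (?g n j) \<omega> * (W (?g n (Suc j)) \<omega> - W (?g n j) \<omega>))"
          unfolding simple_integral_grid[OF \<open>0 < T\<close> k]
          using bd k by (intro sum.cong) (auto simp: truncate_eq)
        moreover have "(LINT s:{0..?g n k}|lborel. ?u s \<omega>) = - a * ?J"
          by (simp only: set_integral_mult_right)
        moreover have "(\<Sum>j<k. - a * Y (?g n j) \<omega> * (T / real n)) = - a * (\<Sum>j<k. Y (?g n j) \<omega> * (T / real n))"
          by (simp add: sum_distrib_left mult.assoc)
        ultimately have "residual a Y T n k \<omega> - (I (?g n k) \<omega> - simple_integral W (?\<psi> n) (?g n k) \<omega>)
            = - a * (?J - (\<Sum>j<k. Y (?g n j) \<omega> * (T / real n)))"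
          using \<open>continuous_on {0..T} (\<lambda>t. Y t \<omega>) \<and> _\<close> by (simp add: right_diff_distrib)
        hence "\<bar>residual a Y T n k \<omega> - (I (?g n k) \<omega> - simple_integral W (?\<psi> n) (?g n k) \<omega>)\<bar>
            = \<bar>a\<bar> * \<bar>?J - (\<Sum>j<k. Y (?g n j) \<omega> * (T / real n))\<bar>"
          by (simp add: abs_mult)
        also have "\<dots> \<le> \<bar>a\<bar> * (\<eta> * ?g n k)"
          using grid_integral_error[OF c \<open>0 < T\<close> k osc] by (intro mult_left_mono) auto
        also have "\<dots> \<le> \<bar>a\<bar> * (\<eta> * T)"
          using grid_le[of T k n] k \<open>0 < T\<close> \<open>0 < \<eta>\<close> by (intro mult_left_mono) auto
        also have "\<dots> \<le> \<epsilon> / 2" using \<eta> by (simp add: mult.assoc)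
        finally show ?thesis .
      qed
      with bd show ?case by (force simp: G_def)
    qed
  qed
  hence G_lim: "(\<lambda>n. prob (G n)) \<longlonglongrightarrow> 0"
    by (intro prob_tendsto_0_AE_eventually G_sets)
  have D_lim: "(\<lambda>n. prob (D \<delta> n)) \<longlonglongrightarrow> 0" if "0 < \<delta>" for \<delta>
  proof (rule prob_tendsto_0_AE_eventually[OF D_sets])
    define \<eta> where "\<eta> = sqrt (\<delta> / T) / (\<bar>a\<bar> + 1)"
    have "0 < \<eta>" using that \<open>0 < T\<close> by (simp add: \<eta>_def)
    have "(a * \<eta>)\<^sup>2 \<le> ((\<bar>a\<bar> + 1) * \<eta>)\<^sup>2"
      using \<open>0 < \<eta>\<close> by (simp add: abs_mult flip: abs_le_square_iff)
    also have "\<dots> = \<delta> / T" using that \<open>0 < T\<close> by (simp add: \<eta>_def)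
    finally have \<eta>: "(a * \<eta>)\<^sup>2 * T \<le> \<delta>" using \<open>0 < T\<close> by (simp add: field_simps)
    show "AE \<omega> in M. \<forall>\<^sub>F n in sequentially. \<omega> \<notin> D \<delta> n"
      using good
    proof eventually_elim
      case (elim \<omega>)
      hence c: "continuous_on {0..T} (\<lambda>t. Y t \<omega>)" by simp
      from eventually_grid_approximation[OF c \<open>0 < T\<close> \<open>0 < \<eta>\<close>] show ?case
      proof eventually_elim
        case (elim n)
        have "sq_dist T (simple_process (?\<psi> n)) ?u \<omega> \<le> ennreal ((a * \<eta>)\<^sup>2 * T)"
          using elim by (intro grid_sq_dist_le \<open>0 < T\<close>) auto
        also have "\<dots> \<le> ennreal \<delta>" using \<eta> by (rule ennreal_leI)
        finally show ?case by (simp add: D_def not_less)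
      qed
    qed
  qed
  have C_bound: "prob (C n) \<le> prob (D \<delta> n) + 4 * \<delta> / (\<epsilon> / 4)\<^sup>2" if "0 < \<delta>" for \<delta> n
    unfolding C_def D_def
    using \<open>0 < T\<close> \<open>0 < \<epsilon>\<close> that g_nn grid_le[of T _ n] I[of T]
    by (intro ito_integral_maximal_inequality[where IT="I T"] I \<psi>) auto
  have B_bound: "prob (B n) \<le> prob (G n) + prob (C n)" for n
  proof -
    have "prob (B n) \<le> prob (G n \<union> C n)"
    proof (rule finite_measure_mono)
      show "B n \<subseteq> G n \<union> C n"
      proof (rule subsetI, rule ccontr)
        fix \<omega> assume \<omega>: "\<omega> \<in> B n" "\<omega> \<notin> G n \<union> C n"
        then obtain k where k: "k \<le> n" "real n < \<bar>Y (?g n k) \<omega>\<bar> \<or> \<epsilon> < \<bar>residual a Y T n k \<omega>\<bar>"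
          and "\<omega> \<in> space M" by (auto simp: B_def)
        with \<omega>(2) have "\<bar>Y (?g n k) \<omega>\<bar> \<le> real n"
          "\<bar>residual a Y T n k \<omega> - (I (?g n k) \<omega> - simple_integral W (?\<psi> n) (?g n k) \<omega>)\<bar> \<le> \<epsilon> / 2"
          "\<bar>I (?g n k) \<omega> - simple_integral W (?\<psi> n) (?g n k) \<omega>\<bar> \<le> \<epsilon> / 2"
          by (auto simp: G_def C_def not_less)
        with k(2) show False by linarith
      qed
    qed (use G_sets C_sets in simp)
    also have "\<dots> \<le> prob (G n) + prob (C n)" using G_sets C_sets by (rule measure_Un_le)
    finally show ?thesis .
  qed
  have "(\<lambda>n. prob (B n)) \<longlonglongrightarrow> 0"
  proof (rule LIMSEQ_I)
    fix r :: real assume "0 < r"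
    \<comment> \<open>\<delta> is fixed before \<open>n\<close> tends to infinity, so that
      \<open>D\<close> vanishes and the remaining term of \<open>C_bound\<close> equals
      \<open>r / 2\<close>.\<close>
    define \<delta> where "\<delta> = r * (\<epsilon> / 4)\<^sup>2 / 8"
    have \<delta>: "0 < \<delta>" "4 * \<delta> / (\<epsilon> / 4)\<^sup>2 = r / 2"
      using \<open>0 < r\<close> \<open>0 < \<epsilon>\<close> by (auto simp: \<delta>_def power_divide)
    have "(\<lambda>n. prob (G n) + (prob (D \<delta> n) + 4 * \<delta> / (\<epsilon> / 4)\<^sup>2)) \<longlonglongrightarrow> 0 + (0 + r / 2)"
      unfolding \<delta>(2) by (intro tendsto_add tendsto_const G_lim D_lim \<delta>)
    hence "\<forall>\<^sub>F n in sequentially. prob (G n) + (prob (D \<delta> n) + 4 * \<delta> / (\<epsilon> / 4)\<^sup>2) < r"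
      by (rule order_tendstoD(2)) (use \<open>0 < r\<close> in simp)
    hence "\<forall>\<^sub>F n in sequentially. norm (prob (B n) - 0) < r"
    proof eventually_elim
      case (elim n)
      thus ?case using B_bound[of n] C_bound[OF \<delta>(1), of n] by simp
    qed
    thus "\<exists>no. \<forall>n\<ge>no. norm (prob (B n) - 0) < r" by (simp add: eventually_sequentially)
  qed
  thus ?thesis by (simp add: B_def[abs_def])
qed

text \<open>With the residual as perturbation \<open>r\<close> the scheme reproduces \<open>Y - r\<close> exactly on the grid.\<close>

primrec euler :: "real \<Rightarrow> real \<Rightarrow> nat \<Rightarrow> ('a \<Rightarrow> real) \<Rightarrow> (nat \<Rightarrow> 'a \<Rightarrow> real) \<Rightarrow> nat \<Rightarrow> 'a \<Rightarrow> real" where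
  "euler a T n X r 0 = X"
| "euler a T n X r (Suc k) = (\<lambda>\<omega>. euler a T n X r k \<omega> - a * (euler a T n X r k \<omega> + r k \<omega>) *
     (T / real n + (W (grid T n (Suc k)) \<omega> - W (grid T n k) \<omega>)))"

text \<open>The scheme is linear in its start and perturbation jointly. This separates the
  unperturbed scheme, whose second moment is explicit, from the propagated error, which starts at
  0.\<close>

lemma euler_split:
  "euler a T n X r k \<omega> = euler a T n X (\<lambda>_ _. 0) k \<omega> + euler a T n (\<lambda>_. 0) r k \<omega>"
  by (induction k) (simp_all add: algebra_simps add_divide_distrib)

lemma euler_step:
  assumes "0 \<le> T" and E: "sq_int (grid T n k) (euler a T n X r k)" and r: "sq_int (grid T n k) (r k)"
  defines "h \<equiv> T / real n"
  shows "sq_int (grid T n (Suc k)) (euler a T n X r (Suc k))"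
    and "expectation (\<lambda>\<omega>. (euler a T n X r (Suc k) \<omega>)\<^sup>2)
      = expectation (\<lambda>\<omega>. ((1 - a * h) * euler a T n X r k \<omega> + (- a * h) * r k \<omega>)\<^sup>2)
        + h * expectation (\<lambda>\<omega>. (- a * euler a T n X r k \<omega> + (- a) * r k \<omega>)\<^sup>2)"
proof -
  let ?U = "\<lambda>\<omega>. (1 - a * h) * euler a T n X r k \<omega> + (- a * h) * r k \<omega>"
  let ?V = "\<lambda>\<omega>. - a * euler a T n X r k \<omega> + (- a) * r k \<omega>"
  have eq: "euler a T n X r (Suc k) = (\<lambda>\<omega>. ?U \<omega> + ?V \<omega> * (W (grid T n (Suc k)) \<omega> - W (grid T n k) \<omega>))"
    by (simp add: fun_eq_iff h_def algebra_simps)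
  have "sq_int (grid T n k) ?U" "sq_int (grid T n k) ?V"
    using E r by (intro sq_int_lin; simp)+
  note inc = increment_sq[OF grid_nonneg[OF assms(1)] grid_mono[OF assms(1)] this, of "Suc k"]
  show "sq_int (grid T n (Suc k)) (euler a T n X r (Suc k))"
    using inc(1) unfolding eq by simp
  show "expectation (\<lambda>\<omega>. (euler a T n X r (Suc k) \<omega>)\<^sup>2)
      = expectation (\<lambda>\<omega>. (?U \<omega>)\<^sup>2) + h * expectation (\<lambda>\<omega>. (?V \<omega>)\<^sup>2)"
    using inc(2) unfolding eq grid_Suc_diff h_def by simp
qed

lemma euler_sq_int:
  assumes "0 \<le> T" "sq_int 0 X" "\<And>j. j < k \<Longrightarrow> sq_int (grid T n j) (r j)"
  shows "sq_int (grid T n k) (euler a T n X r k)"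
  using assms(3)
proof (induction k)
  case (Suc k)
  show ?case using Suc.IH Suc.prems by (intro euler_step(1) assms(1)) auto
qed (use assms in simp)

lemma sq_int_zero: "sq_int t (\<lambda>_. 0)"
  by (simp add: sq_int_def)

lemma euler_second_moment:
  assumes "0 \<le> T" "sq_int 0 X"
  shows "expectation (\<lambda>\<omega>. (euler a T n X (\<lambda>_ _. 0) k \<omega>)\<^sup>2)
    = ((1 - a * (T / real n))\<^sup>2 + a\<^sup>2 * (T / real n)) ^ k * expectation (\<lambda>\<omega>. (X \<omega>)\<^sup>2)"
proof (induction k)
  case (Suc k)
  have "expectation (\<lambda>\<omega>. (euler a T n X (\<lambda>_ _. 0) (Suc k) \<omega>)\<^sup>2)
      = ((1 - a * (T / real n))\<^sup>2 + a\<^sup>2 * (T / real n)) *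
        expectation (\<lambda>\<omega>. (euler a T n X (\<lambda>_ _. 0) k \<omega>)\<^sup>2)"
    using euler_step(2)[OF assms(1) euler_sq_int[OF assms(1,2) sq_int_zero] sq_int_zero]
    by (simp add: power_mult_distrib distrib_right mult.assoc mult.left_commute del: euler.simps)
  thus ?case using Suc by (simp del: euler.simps)
qed simp

text \<open>Adding \<open>\<epsilon>^2\<close> to the moment \<open>m\<close> turns the affine
  recursion \<open>m' \<le> (1 + K h) m + K h \<epsilon>^2\<close> into the homogeneous
  \<open>m' + \<epsilon>^2 \<le> (1 + K h) (m + \<epsilon>^2)\<close>. The hypothesis
  \<open>T \<le> real n\<close> gives the \<open>h \<le> 1\<close> needed for one step.\<close>

lemma euler_error_second_moment:
  fixes a :: real
  assumes T: "0 < T" and n: "T \<le> real n" and "0 < \<epsilon>"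
    and r_meas: "\<And>k. r k \<in> borel_measurable (F (grid T n k))"
    and r_le: "\<And>k \<omega>. \<bar>r k \<omega>\<bar> \<le> \<epsilon>"
  defines "K \<equiv> 3 * \<bar>a\<bar> + 4 * a\<^sup>2"
  shows "expectation (\<lambda>\<omega>. (euler a T n (\<lambda>_. 0) r k \<omega>)\<^sup>2) + \<epsilon>\<^sup>2 \<le> (1 + K * (T / real n)) ^ k * \<epsilon>\<^sup>2"
proof (induction k)
  case (Suc k)
  let ?h = "T / real n"
  let ?E = "euler a T n (\<lambda>_. 0) r"
  have "0 < n" using T n by (cases n) auto
  hence h: "0 \<le> ?h" "?h \<le> 1" using T n by auto
  have "0 \<le> K" by (simp add: K_def)
  have r: "sq_int (grid T n j) (r j)" for j
    using r_meas r_le by (rule sq_int_bounded)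
  have E: "sq_int (grid T n k) (?E k)"
    using T r by (intro euler_sq_int sq_int_zero) auto
  let ?U = "\<lambda>\<omega>. (1 - a * ?h) * ?E k \<omega> + (- a * ?h) * r k \<omega>"
  let ?V = "\<lambda>\<omega>. - a * ?E k \<omega> + (- a) * r k \<omega>"
  have pointwise: "((1 - a * ?h) * x + (- a * ?h) * y)\<^sup>2 + ?h * (- a * x + (- a) * y)\<^sup>2
      \<le> (1 + K * ?h) * x\<^sup>2 + K * ?h * \<epsilon>\<^sup>2" if "\<bar>y\<bar> \<le> \<epsilon>" for x y
    unfolding K_def using h \<open>0 < \<epsilon>\<close> that by (intro euler_error_growth) auto
  have U: "sq_int (grid T n k) ?U" and V: "sq_int (grid T n k) ?V"
    using E r[of k] by (intro sq_int_lin; simp)+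
  have "expectation (\<lambda>\<omega>. (?E (Suc k) \<omega>)\<^sup>2) = expectation (\<lambda>\<omega>. (?U \<omega>)\<^sup>2 + ?h * (?V \<omega>)\<^sup>2)"
    using euler_step(2)[OF _ E r] T U V by (simp add: sq_int_def)
  also have "\<dots> \<le> expectation (\<lambda>\<omega>. (1 + K * ?h) * (?E k \<omega>)\<^sup>2 + K * ?h * \<epsilon>\<^sup>2)"
    using U V E r_le by (intro integral_mono pointwise) (auto simp: sq_int_def)
  also have "\<dots> = (1 + K * ?h) * expectation (\<lambda>\<omega>. (?E k \<omega>)\<^sup>2) + K * ?h * \<epsilon>\<^sup>2"
    using E by (simp add: sq_int_def prob_space)
  finally have "expectation (\<lambda>\<omega>. (?E (Suc k) \<omega>)\<^sup>2) + \<epsilon>\<^sup>2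
      \<le> (1 + K * ?h) * (expectation (\<lambda>\<omega>. (?E k \<omega>)\<^sup>2) + \<epsilon>\<^sup>2)"
    by (simp add: algebra_simps)
  also have "\<dots> \<le> (1 + K * ?h) * ((1 + K * ?h) ^ k * \<epsilon>\<^sup>2)"
    using Suc mult_nonneg_nonneg[OF \<open>0 \<le> K\<close> h(1)] by (intro mult_left_mono) linarith+
  finally show ?case by simp
qed simp

lemma euler_perturbed_exact:
  assumes k: "k \<le> n"
    and bd: "\<And>j. j \<le> n \<Longrightarrow> \<bar>Y (grid T n j) \<omega>\<bar> \<le> real n"
    and res: "\<And>j. j \<le> n \<Longrightarrow> \<bar>residual a Y T n j \<omega>\<bar> \<le> \<epsilon>"
  shows "Y (grid T n k) \<omega>
    = euler a T n (Y 0) (\<lambda>j \<omega>. truncate \<epsilon> (residual a Y T n j \<omega>)) k \<omega> + residual a Y T n k \<omega>"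
  using k
proof (induction k)
  case 0
  show ?case by (simp add: residual_def)
next
  case (Suc k)
  let ?d = "T / real n + (W (grid T n (Suc k)) \<omega> - W (grid T n k) \<omega>)"
  let ?e = "euler a T n (Y 0) (\<lambda>j \<omega>. truncate \<epsilon> (residual a Y T n j \<omega>))"
  have IH: "Y (grid T n k) \<omega> = ?e k \<omega> + residual a Y T n k \<omega>" using Suc by simp
  have "residual a Y T n (Suc k) \<omega> = Y (grid T n (Suc k)) \<omega> - (Y (grid T n k) \<omega> - residual a Y T n k \<omega>)
      - (- a * truncate (real n) (Y (grid T n k) \<omega>) * ?d)"
    by (simp add: residual_def)
  moreover have "truncate (real n) (Y (grid T n k) \<omega>) = Y (grid T n k) \<omega>"
    using bd[of k] Suc.prems by (simp add: truncate_eq)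
  moreover have "truncate \<epsilon> (residual a Y T n k \<omega>) = residual a Y T n k \<omega>"
    using res[of k] Suc.prems by (simp add: truncate_eq)
  ultimately show ?case by (simp add: IH)
qed

lemma euler_tendsto_in_prob:
  assumes eq: "state_equation M F W (\<lambda>t \<omega>. - a * Y t \<omega>) Y" and "0 < T" "0 < \<kappa>"
  shows "(\<lambda>n. prob {\<omega>\<in>space M. 2 * \<kappa> < \<bar>Y T \<omega> - euler a T n (Y 0) (\<lambda>_ _. 0) n \<omega>\<bar>}) \<longlonglongrightarrow> 0"
proof (rule LIMSEQ_I)
  fix p :: real assume "0 < p"
  define K where "K = 3 * \<bar>a\<bar> + 4 * a\<^sup>2"
  \<comment> \<open>The first entry bounds the residual at time \<open>T\<close> itself by \<kappa>.
    The second makes the Chebyshev bound \<open>exp (K * T) * \<epsilon>^2 / \<kappa>^2\<close> for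
    the propagated error at most \<open>p / 2\<close>. These two errors account for
    \<open>2 * \<kappa>\<close>.\<close>
  define \<epsilon> where "\<epsilon> = min \<kappa> (\<kappa> * sqrt (p / (2 * exp (K * T))))"
  have \<epsilon>: "0 < \<epsilon>" "\<epsilon> \<le> \<kappa>" using \<open>0 < \<kappa>\<close> \<open>0 < p\<close> by (auto simp: \<epsilon>_def)
  have "\<epsilon>\<^sup>2 \<le> (\<kappa> * sqrt (p / (2 * exp (K * T))))\<^sup>2"
    using \<epsilon>(1) by (intro power_mono) (auto simp: \<epsilon>_def)
  also have "\<dots> = \<kappa>\<^sup>2 * (p / (2 * exp (K * T)))"
    using \<open>0 < p\<close> by (simp add: power_mult_distrib)
  finally have \<epsilon>2: "exp (K * T) * \<epsilon>\<^sup>2 / \<kappa>\<^sup>2 \<le> p / 2"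
    using \<open>0 < \<kappa>\<close> by (simp add: field_simps)
  define B where "B n = {\<omega>\<in>space M. \<exists>k\<le>n. real n < \<bar>Y (grid T n k) \<omega>\<bar> \<or> \<epsilon> < \<bar>residual a Y T n k \<omega>\<bar>}" for n
  have B_lim: "(\<lambda>n. prob (B n)) \<longlonglongrightarrow> 0"
    unfolding B_def by (rule residual_uniformly_small[OF eq \<open>0 < T\<close> \<epsilon>(1)])
  from eq have Y: "adapted F Y" by (simp add: state_equation_def)
  have B_sets: "B n \<in> sets M" for n
  proof -
    have [measurable]: "Y (grid T n k) \<in> borel_measurable M" "residual a Y T n k \<in> borel_measurable M" for k
      using Y grid_nonneg[of T n k] residual_measurable[OF Y, of T a n k] \<open>0 < T\<close>
      by (auto simp: adapted_def intro: measurable_F[of _ "grid T n k"])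
    have "B n = (\<Union>k\<in>{..n}. {\<omega>\<in>space M. real n < \<bar>Y (grid T n k) \<omega>\<bar> \<or> \<epsilon> < \<bar>residual a Y T n k \<omega>\<bar>})"
      by (auto simp: B_def)
    also have "\<dots> \<in> sets M" by measurable
    finally show ?thesis .
  qed
  let ?E = "\<lambda>n. euler a T n (Y 0) (\<lambda>_ _. 0) n"
  have bound: "prob {\<omega>\<in>space M. 2 * \<kappa> < \<bar>Y T \<omega> - ?E n \<omega>\<bar>} \<le> prob (B n) + p / 2"
    if n: "T \<le> real n" for n
  proof -
    have "0 < n" using n \<open>0 < T\<close> by (cases n) auto
    let ?r = "\<lambda>j \<omega>. truncate \<epsilon> (residual a Y T n j \<omega>)"
    let ?\<eta> = "euler a T n (\<lambda>_. 0) ?r n"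
    have r_meas: "?r k \<in> borel_measurable (F (grid T n k))" for k
      using residual_measurable[OF Y, of T a n k] \<open>0 < T\<close> by simp
    have r_le: "\<bar>?r k \<omega>\<bar> \<le> \<epsilon>" for k \<omega> using abs_truncate_le \<epsilon>(1) by simp
    have "sq_int (grid T n j) (?r j)" for j
      using r_meas r_le by (rule sq_int_bounded)
    hence \<eta>_sq: "sq_int (grid T n n) ?\<eta>"
      using \<open>0 < T\<close> by (intro euler_sq_int sq_int_zero) auto
    hence \<eta>_meas: "?\<eta> \<in> borel_measurable M" and \<eta>_int: "integrable M (\<lambda>\<omega>. (?\<eta> \<omega>)\<^sup>2)"
      by (auto simp: sq_int_def intro: measurable_F[of _ "grid T n n"])
    have "expectation (\<lambda>\<omega>. (?\<eta> \<omega>)\<^sup>2) + \<epsilon>\<^sup>2 \<le> (1 + K * (T / real n)) ^ n * \<epsilon>\<^sup>2"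
      unfolding K_def using euler_error_second_moment[OF \<open>0 < T\<close> n \<epsilon>(1), of ?r a n] r_meas r_le by simp
    also have "\<dots> \<le> exp (K * (T / real n)) ^ n * \<epsilon>\<^sup>2"
      using \<open>0 < T\<close> by (intro mult_right_mono power_mono) (auto simp: K_def)
    also have "exp (K * (T / real n)) ^ n = exp (K * T)"
      using \<open>0 < n\<close> by (simp flip: exp_of_nat_mult)
    finally have "expectation (\<lambda>\<omega>. (?\<eta> \<omega>)\<^sup>2) \<le> exp (K * T) * \<epsilon>\<^sup>2"
      by (smt (verit) zero_le_power2)
    hence "expectation (\<lambda>\<omega>. (?\<eta> \<omega>)\<^sup>2) / \<kappa>\<^sup>2 \<le> p / 2"
      using \<epsilon>2 by (smt (verit) divide_right_mono zero_le_power2)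
    with prob_abs_gt_le[OF \<eta>_meas \<eta>_int \<open>0 < \<kappa>\<close>]
    have \<eta>_prob: "prob {\<omega>\<in>space M. \<kappa> < \<bar>?\<eta> \<omega>\<bar>} \<le> p / 2" by (rule order_trans)
    have "prob {\<omega>\<in>space M. 2 * \<kappa> < \<bar>Y T \<omega> - ?E n \<omega>\<bar>} \<le> prob (B n \<union> {\<omega>\<in>space M. \<kappa> < \<bar>?\<eta> \<omega>\<bar>})"
    proof (rule finite_measure_mono)
      show "{\<omega>\<in>space M. 2 * \<kappa> < \<bar>Y T \<omega> - ?E n \<omega>\<bar>} \<subseteq> B n \<union> {\<omega>\<in>space M. \<kappa> < \<bar>?\<eta> \<omega>\<bar>}"
      proof (rule subsetI, rule ccontr)
        fix \<omega> assume \<omega>: "\<omega> \<in> {\<omega>\<in>space M. 2 * \<kappa> < \<bar>Y T \<omega> - ?E n \<omega>\<bar>}"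
          and "\<omega> \<notin> B n \<union> {\<omega>\<in>space M. \<kappa> < \<bar>?\<eta> \<omega>\<bar>}"
        hence bd: "\<And>j. j \<le> n \<Longrightarrow> \<bar>Y (grid T n j) \<omega>\<bar> \<le> real n"
          and res: "\<And>j. j \<le> n \<Longrightarrow> \<bar>residual a Y T n j \<omega>\<bar> \<le> \<epsilon>" and \<eta>: "\<bar>?\<eta> \<omega>\<bar> \<le> \<kappa>"
          by (auto simp: B_def not_less)
        have "Y T \<omega> = ?E n \<omega> + ?\<eta> \<omega> + residual a Y T n n \<omega>"
          using euler_perturbed_exact[of n n Y T \<omega> a \<epsilon>, OF order.refl bd res]
          by (simp add: grid_n[OF \<open>0 < n\<close>] euler_split[of a T n "Y 0" ?r])
        moreover have "2 * \<kappa> < \<bar>Y T \<omega> - ?E n \<omega>\<bar>" using \<omega> by simp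
        ultimately show False using res[of n] \<eta> \<epsilon>(2) by linarith
      qed
    qed (use B_sets \<eta>_meas in simp)
    also have "\<dots> \<le> prob (B n) + prob {\<omega>\<in>space M. \<kappa> < \<bar>?\<eta> \<omega>\<bar>}"
      using B_sets \<eta>_meas by (intro measure_Un_le) auto
    finally show ?thesis using \<eta>_prob by simp
  qed
  have "\<forall>\<^sub>F n in sequentially. prob (B n) < p / 2"
    by (rule order_tendstoD(2)[OF B_lim]) (use \<open>0 < p\<close> in simp)
  moreover have "\<forall>\<^sub>F n in sequentially. T < real n"
    using filterlim_real_sequentially unfolding filterlim_at_top_dense by blast
  ultimately have "\<forall>\<^sub>F n in sequentially.
      norm (prob {\<omega>\<in>space M. 2 * \<kappa> < \<bar>Y T \<omega> - ?E n \<omega>\<bar>} - 0) < p"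
  proof eventually_elim
    case (elim n)
    thus ?case using bound[of n] by simp
  qed
  thus "\<exists>no. \<forall>n\<ge>no. norm (prob {\<omega>\<in>space M. 2 * \<kappa> < \<bar>Y T \<omega> - ?E n \<omega>\<bar>} - 0) < p"
    by (simp add: eventually_sequentially)
qed

section \<open>From convergence in probability to decay of the second moment\<close>

text \<open>Convergence in probability alone does not pass to second moments. With the cap
  \<open>L\<close>, the exceptional event contributes at most \<open>L^2\<close> times its
  probability, which vanishes as \<open>n\<close> grows with \<open>L\<close> fixed.\<close>

lemma truncated_second_moment_le:
  assumes eq: "state_equation M F W (\<lambda>t \<omega>. - a * Y t \<omega>) Y" and "0 < T" "0 < \<kappa>" "0 \<le> L"
    and Y0: "integrable M (\<lambda>\<omega>. (Y 0 \<omega>)\<^sup>2)"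
  shows "expectation (\<lambda>\<omega>. (min \<bar>Y T \<omega>\<bar> L)\<^sup>2)
    \<le> (1 + \<kappa>) * (exp (- (2 * a - a\<^sup>2) * T) * expectation (\<lambda>\<omega>. (Y 0 \<omega>)\<^sup>2)) + (4 * \<kappa> + 4 * \<kappa>\<^sup>2)"
proof -
  let ?c = "2 * a - a\<^sup>2"
  let ?E = "\<lambda>n. euler a T n (Y 0) (\<lambda>_ _. 0) n"
  let ?A = "\<lambda>n. {\<omega>\<in>space M. 2 * \<kappa> < \<bar>Y T \<omega> - ?E n \<omega>\<bar>}"
  let ?m = "expectation (\<lambda>\<omega>. (Y 0 \<omega>)\<^sup>2)"
  from eq have Y: "adapted F Y" by (simp add: state_equation_def)
  have YT: "Y T \<in> borel_measurable M" using Y \<open>0 < T\<close> by (auto simp: adapted_def intro: measurable_F[of _ T])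
  have Y0_sq: "sq_int 0 (Y 0)" using Y Y0 by (simp add: sq_int_def adapted_def)
  have bound: "expectation (\<lambda>\<omega>. (min \<bar>Y T \<omega>\<bar> L)\<^sup>2)
      \<le> (1 + \<kappa>) * (exp (- ?c * T + a\<^sup>2 * T\<^sup>2 / real n) * ?m) + (4 * \<kappa> + 4 * \<kappa>\<^sup>2) + L\<^sup>2 * prob (?A n)"
    if "0 < n" for n
  proof -
    have E: "sq_int (grid T n n) (?E n)"
      using \<open>0 < T\<close> by (intro euler_sq_int Y0_sq sq_int_zero) auto
    hence E_meas: "?E n \<in> borel_measurable M" and E_int: "integrable M (\<lambda>\<omega>. (?E n \<omega>)\<^sup>2)"
      by (auto simp: sq_int_def intro: measurable_F[of _ "grid T n n"])
    note [measurable] = YT E_meas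
    have A: "?A n \<in> sets M" by measurable
    have pointwise: "(min \<bar>Y T \<omega>\<bar> L)\<^sup>2 \<le> (1 + \<kappa>) * (?E n \<omega>)\<^sup>2 + (4 * \<kappa> + 4 * \<kappa>\<^sup>2) + L\<^sup>2 * indicator (?A n) \<omega>"
      if "\<omega> \<in> space M" for \<omega>
    proof (cases "\<omega> \<in> ?A n")
      case True
      have "(min \<bar>Y T \<omega>\<bar> L)\<^sup>2 \<le> L\<^sup>2" using \<open>0 \<le> L\<close> by (intro power_mono) auto
      moreover have "0 \<le> (1 + \<kappa>) * (?E n \<omega>)\<^sup>2 + (4 * \<kappa> + 4 * \<kappa>\<^sup>2)" using \<open>0 < \<kappa>\<close> by simp
      ultimately show ?thesis using True by simp
    next
      case False
      with that have le: "\<bar>Y T \<omega>\<bar> \<le> \<bar>?E n \<omega>\<bar> + 2 * \<kappa>" by auto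
      have "(min \<bar>Y T \<omega>\<bar> L)\<^sup>2 \<le> (\<bar>?E n \<omega>\<bar> + 2 * \<kappa>)\<^sup>2"
        using le \<open>0 \<le> L\<close> by (intro power_mono) auto
      \<comment> \<open>The mixed term \<open>4 * \<kappa> * \<bar>E\<bar>\<close> is absorbed into
        \<open>\<kappa> * E^2 + 4 * \<kappa>\<close>; the gap is the final square.\<close>
      also have "\<dots> = (1 + \<kappa>) * (?E n \<omega>)\<^sup>2 + (4 * \<kappa> + 4 * \<kappa>\<^sup>2) - \<kappa> * (\<bar>?E n \<omega>\<bar> - 2)\<^sup>2"
        by (simp add: power2_sum power2_diff algebra_simps)
      also have "\<dots> \<le> (1 + \<kappa>) * (?E n \<omega>)\<^sup>2 + (4 * \<kappa> + 4 * \<kappa>\<^sup>2)" using \<open>0 < \<kappa>\<close> by simp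
      finally show ?thesis using False by simp
    qed
    have "expectation (\<lambda>\<omega>. (min \<bar>Y T \<omega>\<bar> L)\<^sup>2)
        \<le> expectation (\<lambda>\<omega>. (1 + \<kappa>) * (?E n \<omega>)\<^sup>2 + (4 * \<kappa> + 4 * \<kappa>\<^sup>2) + L\<^sup>2 * indicator (?A n) \<omega>)"
    proof (rule integral_mono)
      show "integrable M (\<lambda>\<omega>. (min \<bar>Y T \<omega>\<bar> L)\<^sup>2)"
      proof (rule integrable_const_bound[where B="L\<^sup>2"])
        have "(min \<bar>Y T \<omega>\<bar> L)\<^sup>2 \<le> L\<^sup>2" for \<omega> using \<open>0 \<le> L\<close> by (intro power_mono) auto
        thus "AE \<omega> in M. norm ((min \<bar>Y T \<omega>\<bar> L)\<^sup>2) \<le> L\<^sup>2" by simp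
      qed measurable
      show "integrable M (\<lambda>\<omega>. (1 + \<kappa>) * (?E n \<omega>)\<^sup>2 + (4 * \<kappa> + 4 * \<kappa>\<^sup>2) + L\<^sup>2 * indicator (?A n) \<omega>)"
        using E_int A by (intro Bochner_Integration.integrable_add integrable_mult_right) (auto simp: emeasure_eq_measure)
    qed (use pointwise in auto)
    also have "\<dots> = (1 + \<kappa>) * expectation (\<lambda>\<omega>. (?E n \<omega>)\<^sup>2) + (4 * \<kappa> + 4 * \<kappa>\<^sup>2) + L\<^sup>2 * prob (?A n)"
    proof -
      have "integrable M (indicator (?A n) :: 'a \<Rightarrow> real)" using A by (simp add: emeasure_eq_measure)
      moreover have "expectation (indicator (?A n)) = prob (?A n)"
        using A by (simp add: Int_absorb1 sets.sets_into_space)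
      ultimately show ?thesis using E_int by (simp add: prob_space)
    qed
    also have "expectation (\<lambda>\<omega>. (?E n \<omega>)\<^sup>2) \<le> exp (- ?c * T + a\<^sup>2 * T\<^sup>2 / real n) * ?m"
    proof -
      let ?h = "T / real n"
      let ?q = "(1 - a * ?h)\<^sup>2 + a\<^sup>2 * ?h"
      have "0 \<le> ?q" using \<open>0 < T\<close> by simp
      \<comment> \<open>After \<open>n\<close> steps the linear part gives \<open>- ?c * T\<close>
        exactly, and the quadratic part gives \<open>a^2 * T^2 / n\<close>, which disappears in the
        limit.\<close>
      have "?q = 1 + (- ?c * ?h + a\<^sup>2 * ?h\<^sup>2)"
        by (simp add: power2_eq_square algebra_simps)
      also have "\<dots> \<le> exp (- ?c * ?h + a\<^sup>2 * ?h\<^sup>2)" by (rule exp_ge_add_one_self)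
      finally have "?q ^ n \<le> exp (- ?c * ?h + a\<^sup>2 * ?h\<^sup>2) ^ n"
        using \<open>0 \<le> ?q\<close> by (rule power_mono)
      also have "\<dots> = exp (- ?c * T + a\<^sup>2 * T\<^sup>2 / real n)"
        using that by (simp flip: exp_of_nat_mult) (simp add: field_simps power2_eq_square)
      finally have "?q ^ n * ?m \<le> exp (- ?c * T + a\<^sup>2 * T\<^sup>2 / real n) * ?m"
        by (rule mult_right_mono) simp
      thus ?thesis using euler_second_moment[OF _ Y0_sq, of T a n n] \<open>0 < T\<close> by simp
    qed
    finally show ?thesis using \<open>0 < \<kappa>\<close> by (simp add: mult_left_mono)
  qed
  have inv0: "(\<lambda>n. a\<^sup>2 * T\<^sup>2 / real n) \<longlonglongrightarrow> 0"
    by (rule lim_const_over_n)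
  have "(\<lambda>n. (1 + \<kappa>) * (exp (- ?c * T + a\<^sup>2 * T\<^sup>2 / real n) * ?m) + (4 * \<kappa> + 4 * \<kappa>\<^sup>2) + L\<^sup>2 * prob (?A n))
      \<longlonglongrightarrow> (1 + \<kappa>) * (exp (- ?c * T + 0) * ?m) + (4 * \<kappa> + 4 * \<kappa>\<^sup>2) + L\<^sup>2 * 0"
    by (intro tendsto_add tendsto_mult tendsto_const tendsto_exp inv0
        euler_tendsto_in_prob[OF eq \<open>0 < T\<close> \<open>0 < \<kappa>\<close>])
  hence "expectation (\<lambda>\<omega>. (min \<bar>Y T \<omega>\<bar> L)\<^sup>2)
      \<le> (1 + \<kappa>) * (exp (- ?c * T + 0) * ?m) + (4 * \<kappa> + 4 * \<kappa>\<^sup>2) + L\<^sup>2 * 0"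
    by (rule LIMSEQ_le_const) (intro exI[of _ 1] allI impI bound, simp)
  thus ?thesis by simp
qed

text \<open>First \<kappa> tends to 0 with the cap \<open>L\<close> fixed, then \<open>L\<close> to
  infinity by monotone convergence. The nonnegative integral on the left makes finiteness of the
  second moment part of the conclusion.\<close>

lemma second_moment_decay:
  assumes eq: "state_equation M F W (\<lambda>t \<omega>. - a * Y t \<omega>) Y" and "0 < T"
    and Y0: "integrable M (\<lambda>\<omega>. (Y 0 \<omega>)\<^sup>2)"
  shows "(\<integral>\<^sup>+\<omega>. ennreal ((Y T \<omega>)\<^sup>2) \<partial>M)
    \<le> ennreal (exp (- (2 * a - a\<^sup>2) * T) * expectation (\<lambda>\<omega>. (Y 0 \<omega>)\<^sup>2))"
proof -
  let ?R = "exp (- (2 * a - a\<^sup>2) * T) * expectation (\<lambda>\<omega>. (Y 0 \<omega>)\<^sup>2)"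
  have [measurable]: "Y T \<in> borel_measurable M"
    using eq \<open>0 < T\<close> by (auto simp: state_equation_def adapted_def intro: measurable_F[of _ T])
  have trunc: "expectation (\<lambda>\<omega>. (min \<bar>Y T \<omega>\<bar> (real L))\<^sup>2) \<le> ?R" for L :: nat
  proof -
    let ?k = "\<lambda>n. inverse (real (Suc n))"
    have "(\<lambda>n. (1 + ?k n) * ?R + (4 * ?k n + 4 * (?k n)\<^sup>2)) \<longlonglongrightarrow> (1 + 0) * ?R + (4 * 0 + 4 * 0\<^sup>2)"
      by (intro tendsto_intros LIMSEQ_inverse_real_of_nat)
    hence "expectation (\<lambda>\<omega>. (min \<bar>Y T \<omega>\<bar> (real L))\<^sup>2) \<le> (1 + 0) * ?R + (4 * 0 + 4 * 0\<^sup>2)"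
      by (rule LIMSEQ_le_const)
         (intro exI[of _ 0] allI impI truncated_second_moment_le[OF eq \<open>0 < T\<close> _ _ Y0]; simp)
    thus ?thesis by simp
  qed
  have sup: "(SUP L. ennreal ((min \<bar>Y T \<omega>\<bar> (real L))\<^sup>2)) = ennreal ((Y T \<omega>)\<^sup>2)" for \<omega>
  proof (rule antisym)
    show "(SUP L. ennreal ((min \<bar>Y T \<omega>\<bar> (real L))\<^sup>2)) \<le> ennreal ((Y T \<omega>)\<^sup>2)"
    proof (rule SUP_least)
      fix L
      have "(min \<bar>Y T \<omega>\<bar> (real L))\<^sup>2 \<le> \<bar>Y T \<omega>\<bar>\<^sup>2" by (intro power_mono) auto
      thus "ennreal ((min \<bar>Y T \<omega>\<bar> (real L))\<^sup>2) \<le> ennreal ((Y T \<omega>)\<^sup>2)" by (simp add: ennreal_leI)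
    qed
    obtain L :: nat where "\<bar>Y T \<omega>\<bar> \<le> real L" using real_arch_simple by blast
    thus "ennreal ((Y T \<omega>)\<^sup>2) \<le> (SUP L. ennreal ((min \<bar>Y T \<omega>\<bar> (real L))\<^sup>2))"
      by (intro SUP_upper2[of L]) (simp_all add: min_def)
  qed
  have "(\<integral>\<^sup>+\<omega>. ennreal ((Y T \<omega>)\<^sup>2) \<partial>M) = (SUP L. \<integral>\<^sup>+\<omega>. ennreal ((min \<bar>Y T \<omega>\<bar> (real L))\<^sup>2) \<partial>M)"
    unfolding sup[symmetric]
  proof (rule nn_integral_monotone_convergence_SUP)
    show "incseq (\<lambda>L \<omega>. ennreal ((min \<bar>Y T \<omega>\<bar> (real L))\<^sup>2))"
      by (intro incseq_SucI le_funI ennreal_leI power_mono) auto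
  qed measurable
  also have "\<dots> \<le> ennreal ?R"
  proof (rule SUP_least)
    fix L :: nat
    have "integrable M (\<lambda>\<omega>. (min \<bar>Y T \<omega>\<bar> (real L))\<^sup>2)"
    proof (rule integrable_const_bound[where B="(real L)\<^sup>2"])
      have "(min \<bar>Y T \<omega>\<bar> (real L))\<^sup>2 \<le> (real L)\<^sup>2" for \<omega> by (intro power_mono) auto
      thus "AE \<omega> in M. norm ((min \<bar>Y T \<omega>\<bar> (real L))\<^sup>2) \<le> (real L)\<^sup>2" by simp
    qed measurable
    hence "(\<integral>\<^sup>+\<omega>. ennreal ((min \<bar>Y T \<omega>\<bar> (real L))\<^sup>2) \<partial>M)
        = ennreal (expectation (\<lambda>\<omega>. (min \<bar>Y T \<omega>\<bar> (real L))\<^sup>2))"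
      by (intro nn_integral_eq_integral) auto
    thus "(\<integral>\<^sup>+\<omega>. ennreal ((min \<bar>Y T \<omega>\<bar> (real L))\<^sup>2) \<partial>M) \<le> ennreal ?R"
      using trunc by (simp add: ennreal_leI)
  qed
  finally show ?thesis .
qed

lemma state_equation_centered:
  assumes "state_equation M F W (\<lambda>t \<omega>. - a * (x t \<omega> - b)) x"
  shows "state_equation M F W (\<lambda>t \<omega>. - a * (x t \<omega> - b)) (\<lambda>t \<omega>. x t \<omega> - b)"
  using assms unfolding state_equation_def
  by (auto simp: adapted_def continuous_paths_def add.assoc intro!: continuous_on_diff elim!: eventually_mono)

end

section \<open>Initial moments, consensus, and the theorem\<close>

lemma integrable_square_if_nn_integral:
  fixes X :: "'a \<Rightarrow> real"
  assumes "X \<in> borel_measurable M" "(\<integral>\<^sup>+\<omega>. ennreal (\<bar>X \<omega>\<bar>\<^sup>2) \<partial>M) < ennreal c"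
  shows "integrable M (\<lambda>\<omega>. (X \<omega>)\<^sup>2)" "(\<integral>\<omega>. (X \<omega>)\<^sup>2 \<partial>M) \<le> c" "0 < c"
proof -
  show "0 < c" using assms(2) by (metis ennreal_eq_0_iff not_less not_less_zero)
  show int: "integrable M (\<lambda>\<omega>. (X \<omega>)\<^sup>2)"
  proof (rule integrableI_bounded)
    show "(\<integral>\<^sup>+\<omega>. ennreal (norm ((X \<omega>)\<^sup>2)) \<partial>M) < \<infinity>"
      using less_trans[OF assms(2) ennreal_less_top] by simp
  qed (use assms(1) in measurable)
  have "ennreal (\<integral>\<omega>. (X \<omega>)\<^sup>2 \<partial>M) < ennreal c"
    using nn_integral_eq_integral[OF int] assms(2) by simp
  thus "(\<integral>\<omega>. (X \<omega>)\<^sup>2 \<partial>M) \<le> c" by (simp add: ennreal_less_iff)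
qed

text \<open>The common limit is the constant \<open>b\<close>.\<close>

lemma exponential_consensus:
  assumes c: "0 < c2"
    and decay: "\<And>t i. 0 < t \<Longrightarrow> i \<in> {1..N} \<Longrightarrow>
      (\<integral>\<^sup>+\<omega>. ennreal (\<bar>x i t \<omega> - b\<bar>\<^sup>2) \<partial>M) \<le> ennreal (c1 * exp (- c2 * t))"
  shows "mean_square_consensus M N x"
  unfolding mean_square_consensus_def
proof (intro bexI ballI)
  fix i assume i: "i \<in> {1..N}"
  show "((\<lambda>t. \<integral>\<^sup>+\<omega>. ennreal (\<bar>x i t \<omega> - b\<bar>\<^sup>2) \<partial>M) \<longlongrightarrow> 0) at_top"
  proof (rule tendsto_sandwich[where f="\<lambda>_. 0" and h="\<lambda>t. ennreal (c1 * exp (- c2 * t))"])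
    show "\<forall>\<^sub>F t in at_top. (\<integral>\<^sup>+\<omega>. ennreal (\<bar>x i t \<omega> - b\<bar>\<^sup>2) \<partial>M) \<le> ennreal (c1 * exp (- c2 * t))"
      using eventually_gt_at_top[of 0] by eventually_elim (rule decay[OF _ i])
    have "((\<lambda>t. c1 * exp (- c2 * t)) \<longlongrightarrow> c1 * 0) at_top"
      using c by (intro tendsto_mult tendsto_const filterlim_compose[OF exp_at_bot])
        (auto simp: filterlim_uminus_at_bot intro!: filterlim_tendsto_pos_mult_at_top[OF tendsto_const] filterlim_ident)
    from tendsto_ennrealI[OF this] show "((\<lambda>t. ennreal (c1 * exp (- c2 * t))) \<longlongrightarrow> 0) at_top" by simp
  qed auto
qed simp

theorem theorem4p11:
  fixes \<rho> r xbar0 c0 :: real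
  assumes "\<rho> > 0"
    and "r > - 1 / (2 * (2 + \<rho>))"
  shows "\<exists>c1>0. \<exists>c2>0. \<forall>N\<ge>1.
    \<forall>(M :: 'a measure) F (W :: nat \<Rightarrow> real \<Rightarrow> 'a \<Rightarrow> real) (x :: nat \<Rightarrow> real \<Rightarrow> 'a \<Rightarrow> real).
      filtered_prob_space M F \<and>
      independent_noises M F N W \<and>
      assumption_A1 M N W (\<lambda>i. x i 0) xbar0 c0 \<and>
      (\<forall>i\<in>{1..N}. state_equation M F (W i) (strategy \<rho> r xbar0 (x i)) (x i))
      \<longrightarrow>
      (\<forall>t>0. \<forall>i\<in>{1..N}.
         (\<integral>\<^sup>+\<omega>. ennreal (\<bar>x i t \<omega> - xbar0\<bar>\<^sup>2) \<partial>M) \<le> ennreal (c1 * exp (- c2 * t))) \<and>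
      mean_square_consensus M N x"
proof -
  define a where "a = p_coeff \<rho> r / (p_coeff \<rho> r + r)"
  \<comment> \<open>The constants are chosen before \<open>N\<close> and the probability space, when
    the sign of \<open>c0\<close> is still unknown; the form chosen is positive in any case.\<close>
  define c1 where "c1 = \<bar>c0\<bar> + 1"
  define c2 where "c2 = 2 * a - a\<^sup>2"
  have "c2 = a * (2 - a)" by (simp add: c2_def power2_eq_square algebra_simps)
  hence c2: "0 < c2" using feedback_gain_bounds[OF assms, folded a_def] by simp
  have c1: "0 < c1" by (simp add: c1_def)
  have decay: "(\<integral>\<^sup>+\<omega>. ennreal (\<bar>x i t \<omega> - xbar0\<bar>\<^sup>2) \<partial>M) \<le> ennreal (c1 * exp (- c2 * t))"
    if fil: "filtered_prob_space M F" and noise: "independent_noises M F N W"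
      and A1: "assumption_A1 M N W (\<lambda>i. x i 0) xbar0 c0" and i: "i \<in> {1..N}"
      and sol: "state_equation M F (W i) (strategy \<rho> r xbar0 (x i)) (x i)" and "0 < t"
    for N t i and M :: "'a measure" and F W x
  proof -
    interpret prob_space M using fil by (simp add: filtered_prob_space_def)
    interpret brownian_filtration M F "W i"
      by unfold_locales (use fil noise i in \<open>auto simp: independent_noises_def\<close>)
    have mean: "integrable M (x i 0)" "expectation (x i 0) = xbar0"
      and c0: "(\<integral>\<^sup>+\<omega>. ennreal (\<bar>x i 0 \<omega>\<bar>\<^sup>2) \<partial>M) < ennreal c0"
      using A1 i by (auto simp: assumption_A1_def)
    note sq = integrable_square_if_nn_integral[OF borel_measurable_integrable[OF mean(1)] c0]
    let ?Y = "\<lambda>t \<omega>. x i t \<omega> - xbar0"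
    have "state_equation M F (W i) (\<lambda>t \<omega>. - a * ?Y t \<omega>) (x i)"
      using sol by (simp add: strategy_def a_def)
    note eq = state_equation_centered[OF this]
    have Y0_eq: "(\<lambda>\<omega>. (?Y 0 \<omega>)\<^sup>2) = (\<lambda>\<omega>. (x i 0 \<omega>)\<^sup>2 - 2 * xbar0 * x i 0 \<omega> + xbar0\<^sup>2)"
      by (simp add: fun_eq_iff power2_diff)
    have Y0: "integrable M (\<lambda>\<omega>. (?Y 0 \<omega>)\<^sup>2)"
      unfolding Y0_eq using sq(1) mean(1) by simp
    \<comment> \<open>Since \<open>xbar0\<close> is the mean of \<open>x i 0\<close>, this is the
      variance, which is at most the second moment and hence at most \<open>c0\<close>.\<close>
    have "expectation (\<lambda>\<omega>. (?Y 0 \<omega>)\<^sup>2) = expectation (\<lambda>\<omega>. (x i 0 \<omega>)\<^sup>2) - xbar0\<^sup>2"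
      unfolding Y0_eq using sq(1) mean by (simp add: prob_space power2_eq_square)
    also have "\<dots> \<le> c1" using sq(2,3) by (simp add: c1_def) (smt (verit) zero_le_power2)
    finally have m: "expectation (\<lambda>\<omega>. (?Y 0 \<omega>)\<^sup>2) \<le> c1" .
    have "(\<integral>\<^sup>+\<omega>. ennreal ((?Y t \<omega>)\<^sup>2) \<partial>M)
        \<le> ennreal (exp (- (2 * a - a\<^sup>2) * t) * expectation (\<lambda>\<omega>. (?Y 0 \<omega>)\<^sup>2))"
      by (rule second_moment_decay[OF eq \<open>0 < t\<close> Y0])
    also have "\<dots> \<le> ennreal (c1 * exp (- c2 * t))"
      using m unfolding c2_def by (intro ennreal_leI) (simp add: mult.commute mult_left_mono)
    finally show ?thesis by simp
  qed
  show ?thesis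
  proof (rule exI[of _ c1], rule conjI[OF c1], rule exI[of _ c2], rule conjI[OF c2],
      intro allI impI, elim conjE, intro conjI allI impI ballI)
    fix N and M :: "'a measure" and F W x and t :: real and i
    assume "filtered_prob_space M F" "independent_noises M F N W"
      "assumption_A1 M N W (\<lambda>i. x i 0) xbar0 c0"
      "\<forall>i\<in>{1..N}. state_equation M F (W i) (strategy \<rho> r xbar0 (x i)) (x i)"
      "0 < t" "i \<in> {1..N}"
    thus "(\<integral>\<^sup>+\<omega>. ennreal (\<bar>x i t \<omega> - xbar0\<bar>\<^sup>2) \<partial>M) \<le> ennreal (c1 * exp (- c2 * t))"
      using decay by blast
  next
    fix N and M :: "'a measure" and F W x
    assume "filtered_prob_space M F" "independent_noises M F N W"
      "assumption_A1 M N W (\<lambda>i. x i 0) xbar0 c0"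
      "\<forall>i\<in>{1..N}. state_equation M F (W i) (strategy \<rho> r xbar0 (x i)) (x i)"
    thus "mean_square_consensus M N x"
      using decay by (intro exponential_consensus[OF c2]) blast
  qed
qed

end
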